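(* Let $K$ be a field, let $E$ be an arbitrary directed graph, and let $L=L_K(E)$ be the Leavitt path algebra of $E$ over $K$. Let $I$ be a non-zero (two-sided) ideal of $L$. If its radical $\sqrt I$ is a prime ideal, say $P$, then $I=P^n$ for some integer $n\ge 1$.
   Context: Directed graph: $E=(E^0,E^1,r,s)$ consists of two countable sets $E^0$ (vertices) and $E^1$ (edges) and functions $r,s:E^1\to E^0$ (range and source). A vertex $v$ is regular if $s^{-1}(v)$ is non-empty and finite. Leavitt path algebra: $L_K(E)$ is the (associative, not necessarily unital) $K$-algebra generated by $E^0\cup E^1\cup\{e^*: e\in E^1\}$ subject to the relations - $vw=\delta_{v,w}v$ for $v,w\in E^0$; - $s(e)e=e=e\,r(e)$ and $r(e)e^*=e^*=e^*s(e)$ for $e\in E^1$; - (CK1) $e^*f=\delta_{e,f}\,r(f)$ for $e,f\in E^1$; - (CK2) $v=\sum_{e\in s^{-1}(v)}ee^*$ for every regular vertex $v$. Ideals are two-sided; the product $AB$ of ideals is the set of finite sums of elements $ab$ with $a\in A$, $b\in B$, and $P^n$ is the $n$-fold product of $P$ with itself. A prime ideal is a proper ideal $P$ such that, for ideals $A,B$, $AB\subseteq P$ implies $A\subseteq P$ or $B\subseteq P$. The radical $\sqrt I$ of an ideal $I$ in a ring $R$ is the intersection of all the prime ideals of $R$ containing $I$ (so it is $R$ if there are none). *)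

theory Defs
  imports
    "HOL-Algebra.Ideal_Product"
    "HOL-Algebra.QuotRing"
    "HOL-Library.Poly_Mapping"
    "HOL-Library.Countable_Set"
    "Graph_Theory.Digraph"
begin

section \<open>Ideals of rings without identity\<close>

text \<open>
  Leavitt path algebras have no identity when the graph has infinitely many vertices, so the
  locales \<^locale>\<open>ring\<close>, \<^locale>\<open>ideal\<close> and \<^locale>\<open>primeideal\<close> (the last one also commutative) do
  not apply to them.  The record type \<^typ>\<open>'a ring\<close> and the operations of HOL-Algebra that do not
  involve the identity are still used; the field \<^const>\<open>one\<close> is ignored throughout.
\<close>

definition two_sided_ideal :: "'a set \<Rightarrow> ('a, 'b) ring_scheme \<Rightarrow> bool" where
  "two_sided_ideal I R \<longleftrightarrow>
     additive_subgroup I R \<and>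
     (\<forall>a\<in>I. \<forall>x\<in>carrier R. x \<otimes>\<^bsub>R\<^esub> a \<in> I \<and> a \<otimes>\<^bsub>R\<^esub> x \<in> I)"

text \<open>
  The product of ideals is \<^const>\<open>ideal_prod\<close>: finite non-empty sums of products.  The exponent
  \<open>1\<close> gives back \<open>P\<close> itself, which matters since \<open>R P = P\<close> can fail without identity.
\<close>

fun ideal_power :: "('a, 'b) ring_scheme \<Rightarrow> 'a set \<Rightarrow> nat \<Rightarrow> 'a set" where
  "ideal_power R P 0 = carrier R"
| "ideal_power R P (Suc 0) = P"
| "ideal_power R P (Suc (Suc n)) = ideal_prod R (ideal_power R P (Suc n)) P"

definition prime_two_sided_ideal :: "'a set \<Rightarrow> ('a, 'b) ring_scheme \<Rightarrow> bool" where
  "prime_two_sided_ideal P R \<longleftrightarrow>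
     two_sided_ideal P R \<and> P \<noteq> carrier R \<and>
     (\<forall>A B. two_sided_ideal A R \<longrightarrow> two_sided_ideal B R \<longrightarrow>
        ideal_prod R A B \<subseteq> P \<longrightarrow> A \<subseteq> P \<or> B \<subseteq> P)"

definition ideal_radical :: "('a, 'b) ring_scheme \<Rightarrow> 'a set \<Rightarrow> 'a set" where
  "ideal_radical R I =
     {x \<in> carrier R. \<forall>P. prime_two_sided_ideal P R \<and> I \<subseteq> P \<longrightarrow> x \<in> P}"

section \<open>Free algebras\<close>

datatype 'g word = Word (letters: "'g list")

instantiation word :: (type) monoid_add
begin

definition zero_word :: "'g word" where
  "zero_word = Word []"

definition plus_word :: "'g word \<Rightarrow> 'g word \<Rightarrow> 'g word" where
  "plus_word u w = Word (letters u @ letters w)"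

instance
  by standard (simp_all add: zero_word_def plus_word_def)

end

text \<open>
  With words under concatenation as an additively written monoid, \<^typ>\<open>'g word \<Rightarrow>\<^sub>0 'k\<close> with its
  convolution product is the free unital \<open>'k\<close>-algebra on the type \<open>'g\<close>, and
  \<open>Poly_Mapping.single 0 c\<close> is the scalar \<open>c\<close>.
\<close>

text \<open>
  The free algebra without identity on \<open>X\<close> consists of the combinations of non-empty words over
  \<open>X\<close>; the ambient \<open>1\<close> in the field \<^const>\<open>one\<close> lies outside the carrier.
\<close>

definition free_algebra :: "'g set \<Rightarrow> ('g word \<Rightarrow>\<^sub>0 'k::field) ring" where
  "free_algebra X =
     \<lparr>carrier = {p. \<forall>w\<in>Poly_Mapping.keys p. letters w \<noteq> [] \<and> set (letters w) \<subseteq> X},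
      mult = (*), one = 1, zero = 0, add = (+)\<rparr>"

inductive_set algebra_ideal_generated ::
    "'g set \<Rightarrow> ('g word \<Rightarrow>\<^sub>0 'k::field) set \<Rightarrow> ('g word \<Rightarrow>\<^sub>0 'k) set"
  for X :: "'g set" and S :: "('g word \<Rightarrow>\<^sub>0 'k) set" where
  zero: "0 \<in> algebra_ideal_generated X S"
| generator: "p \<in> S \<Longrightarrow> p \<in> algebra_ideal_generated X S"
| add: "p \<in> algebra_ideal_generated X S \<Longrightarrow> q \<in> algebra_ideal_generated X S \<Longrightarrow>
    p + q \<in> algebra_ideal_generated X S"
| scale: "p \<in> algebra_ideal_generated X S \<Longrightarrow>
    Poly_Mapping.single 0 c * p \<in> algebra_ideal_generated X S"
| left: "a \<in> carrier (free_algebra X) \<Longrightarrow> p \<in> algebra_ideal_generated X S \<Longrightarrow>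
    a * p \<in> algebra_ideal_generated X S"
| right: "a \<in> carrier (free_algebra X) \<Longrightarrow> p \<in> algebra_ideal_generated X S \<Longrightarrow>
    p * a \<in> algebra_ideal_generated X S"

section \<open>Leavitt path algebras\<close>

text \<open>
  For a digraph \<open>E\<close>, the source and the range of an edge are \<^const>\<open>tail\<close> and \<^const>\<open>head\<close>.
\<close>

datatype ('v, 'e) lpa_generator = Vertex 'v | Edge 'e | Ghost 'e

definition lpa_generators :: "('v, 'e) pre_digraph \<Rightarrow> ('v, 'e) lpa_generator set" where
  "lpa_generators E = Vertex ` verts E \<union> Edge ` arcs E \<union> Ghost ` arcs E"

definition gen :: "'g \<Rightarrow> 'g word \<Rightarrow>\<^sub>0 'k::field" where
  "gen x = Poly_Mapping.single (Word [x]) 1"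

definition regular_vertex :: "('v, 'e) pre_digraph \<Rightarrow> 'v \<Rightarrow> bool" where
  "regular_vertex E v \<longleftrightarrow> v \<in> verts E \<and> out_arcs E v \<noteq> {} \<and> finite (out_arcs E v)"

text \<open>An element \<open>p - q\<close> of this set stands for the defining relation \<open>p = q\<close>.\<close>

definition lpa_relators ::
    "('v, 'e) pre_digraph \<Rightarrow> (('v, 'e) lpa_generator word \<Rightarrow>\<^sub>0 'k::field) set" where
  "lpa_relators E =
     {gen (Vertex v) * gen (Vertex w) - (if v = w then gen (Vertex v) else 0) | v w.
        v \<in> verts E \<and> w \<in> verts E}
   \<union> {gen (Vertex (tail E e)) * gen (Edge e) - gen (Edge e) | e. e \<in> arcs E}
   \<union> {gen (Edge e) * gen (Vertex (head E e)) - gen (Edge e) | e. e \<in> arcs E}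
   \<union> {gen (Vertex (head E e)) * gen (Ghost e) - gen (Ghost e) | e. e \<in> arcs E}
   \<union> {gen (Ghost e) * gen (Vertex (tail E e)) - gen (Ghost e) | e. e \<in> arcs E}
   \<union> {gen (Ghost e) * gen (Edge f) - (if e = f then gen (Vertex (head E f)) else 0) | e f.
        e \<in> arcs E \<and> f \<in> arcs E}
   \<union> {gen (Vertex v) - (\<Sum>e\<in>out_arcs E v. gen (Edge e) * gen (Ghost e)) | v.
        regular_vertex E v}"

text \<open>
  The field \<open>K\<close> is the type \<open>'k\<close>.  Only the ring structure of \<open>L\<^sub>K(E)\<close> is recorded, scalars having
  been used in forming the ideal of relations.
\<close>

definition leavitt_path_algebra ::
    "('v, 'e) pre_digraph \<Rightarrow> (('v, 'e) lpa_generator word \<Rightarrow>\<^sub>0 'k::field) set ring" where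
  "leavitt_path_algebra E =
     free_algebra (lpa_generators E) Quot
       algebra_ideal_generated (lpa_generators E) (lpa_relators E)"

end

theory Submission
  imports Defs "Graph_Theory.Arc_Walk" "HOL-Computational_Algebra.Polynomial"
begin

text \<open>
  Everything takes place in the free unital algebra on all symbols, modulo the ideal \<open>R\<close> generated by
  the relations together with the symbols that do not belong to the graph; ideals of the Leavitt path
  algebra are the ideals of this algebra that contain \<open>R\<close> and consist of elements without constant term.

  Call the idempotents \<open>v - (\<Sum>e\<in>F. e e\<^sup>*)\<close>, for finite \<open>F \<subseteq> s\<^sup>-\<^sup>1(v)\<close>, gaps.  Repeatedly splitting
  a vertex as \<open>v = (v - (\<Sum>e\<in>F. e e\<^sup>*)) + (\<Sum>e\<in>F. e e\<^sup>*)\<close> on both sides of an element \<open>x\<close> of an ideal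
  \<open>P\<close> shows that \<open>P\<close> is generated by its gaps and by the corners \<open>u P u\<close> at vertices \<open>u\<close> on closed
  walks that have no exits modulo the gaps of \<open>P\<close>.  Only spanning arguments are used, so
  no basis of the Leavitt path algebra is needed.

  If \<open>P\<close> is the radical of \<open>I\<close>, then by Zorn's lemma every element of \<open>P\<close> has a power in \<open>I\<close>, so \<open>I\<close>
  and \<open>P\<close> have the same gaps; let \<open>J\<close> be the ideal they generate.  If no vertex outside \<open>P\<close> lies on an
  exitless closed walk, then \<open>I = P = J\<close>.  Otherwise, as \<open>P\<close> is prime, one such vertex \<open>u\<close> suffices.
  Its corner is commutative modulo \<open>J\<close>, consisting of Laurent polynomials in the shortest closed walk at
  \<open>u\<close>, so \<open>P\<close> and \<open>I\<close> correspond to polynomials \<open>f\<close> and \<open>g\<close>, where \<open>f\<close> is zero or prime and \<open>g\<close> divides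
  a power of \<open>f\<close>.  Hence \<open>g\<close> is associated to some \<open>f\<^sup>n\<close>, and \<open>I = P\<^sup>n\<close>.
\<close>

section \<open>Ideals and congruences\<close>

text \<open>The ambient ring has an identity, so multiplication by -1 makes such a set an additive
  subgroup.\<close>

definition ring_ideal :: "'a::ring_1 set \<Rightarrow> bool" where
  "ring_ideal T \<longleftrightarrow>
     0 \<in> T \<and> (\<forall>x\<in>T. \<forall>y\<in>T. x + y \<in> T) \<and> (\<forall>x\<in>T. \<forall>a. a * x \<in> T \<and> x * a \<in> T)"

definition cg :: "'a::ring_1 set \<Rightarrow> 'a \<Rightarrow> 'a \<Rightarrow> bool" where
  "cg T x y \<longleftrightarrow> x - y \<in> T"

lemma ring_idealI:
  assumes "0 \<in> T" "\<And>x y. x \<in> T \<Longrightarrow> y \<in> T \<Longrightarrow> x + y \<in> T"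
    and "\<And>x a. x \<in> T \<Longrightarrow> a * x \<in> T" "\<And>x a. x \<in> T \<Longrightarrow> x * a \<in> T"
  shows "ring_ideal T"
  using assms by (auto simp: ring_ideal_def)

context
  fixes T :: "'a::ring_1 set"
  assumes T: "ring_ideal T"
begin

lemma ideal_zero: "0 \<in> T"
  and ideal_add: "x \<in> T \<Longrightarrow> y \<in> T \<Longrightarrow> x + y \<in> T"
  and ideal_left: "x \<in> T \<Longrightarrow> a * x \<in> T"
  and ideal_right: "x \<in> T \<Longrightarrow> x * a \<in> T"
  using T by (auto simp: ring_ideal_def)

lemma ideal_minus: "x \<in> T \<Longrightarrow> - x \<in> T"
  using ideal_left[of x "-1"] by simp

lemma ideal_diff: "x \<in> T \<Longrightarrow> y \<in> T \<Longrightarrow> x - y \<in> T"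
  using ideal_add[of x "-y"] ideal_minus[of y] by simp

lemma ideal_sum: "(\<And>i. i \<in> A \<Longrightarrow> f i \<in> T) \<Longrightarrow> sum f A \<in> T"
  by (induction A rule: infinite_finite_induct) (auto simp: ideal_zero ideal_add)

lemma cg_refl: "cg T x x"
  by (simp add: cg_def ideal_zero)

lemma cg_sym: "cg T x y \<Longrightarrow> cg T y x"
  using ideal_minus[of "x - y"] by (simp add: cg_def)

lemma cg_trans [trans]: "cg T x y \<Longrightarrow> cg T y z \<Longrightarrow> cg T x z"
  using ideal_add[of "x - y" "y - z"] by (simp add: cg_def)

lemma cg_add: "cg T x y \<Longrightarrow> cg T z w \<Longrightarrow> cg T (x + z) (y + w)"
  using ideal_add[of "x - y" "z - w"] by (simp add: cg_def algebra_simps)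

lemma cg_diff: "cg T x y \<Longrightarrow> cg T z w \<Longrightarrow> cg T (x - z) (y - w)"
  using ideal_diff[of "x - y" "z - w"] by (simp add: cg_def algebra_simps)

lemma cg_left: "cg T x y \<Longrightarrow> cg T (a * x) (a * y)"
  using ideal_left[of "x - y" a] by (simp add: cg_def algebra_simps)

lemma cg_right: "cg T x y \<Longrightarrow> cg T (x * a) (y * a)"
  using ideal_right[of "x - y" a] by (simp add: cg_def algebra_simps)

lemma cg_mult: "cg T x y \<Longrightarrow> cg T z w \<Longrightarrow> cg T (x * z) (y * w)"
  by (rule cg_trans[OF cg_right cg_left])

lemma cg_sum: "(\<And>i. i \<in> A \<Longrightarrow> cg T (f i) (g i)) \<Longrightarrow> cg T (sum f A) (sum g A)"
  using ideal_sum[of A "\<lambda>i. f i - g i"] by (simp add: cg_def sum_subtractf)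

lemma cg_0_iff: "cg T x 0 \<longleftrightarrow> x \<in> T"
  by (simp add: cg_def)

lemma cg_mem_iff: "cg T x y \<Longrightarrow> x \<in> T \<longleftrightarrow> y \<in> T"
  using ideal_add[of "x - y" y] ideal_diff[of x "x - y"] by (auto simp: cg_def)

end

lemma cg_mono: "cg S x y \<Longrightarrow> S \<subseteq> T \<Longrightarrow> cg T x y"
  by (auto simp: cg_def)

lemma cg_mem: "ring_ideal T \<Longrightarrow> R \<subseteq> T \<Longrightarrow> cg R x y \<Longrightarrow> y \<in> T \<Longrightarrow> x \<in> T"
  by (meson cg_mem_iff cg_mono)

inductive_set generated_ideal :: "'a::ring_1 set \<Rightarrow> 'a set" for G where
  base: "x \<in> G \<Longrightarrow> x \<in> generated_ideal G"
| zero: "0 \<in> generated_ideal G"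
| add: "x \<in> generated_ideal G \<Longrightarrow> y \<in> generated_ideal G \<Longrightarrow> x + y \<in> generated_ideal G"
| left: "x \<in> generated_ideal G \<Longrightarrow> a * x \<in> generated_ideal G"
| right: "x \<in> generated_ideal G \<Longrightarrow> x * a \<in> generated_ideal G"

lemma ring_ideal_generated: "ring_ideal (generated_ideal G)"
  by (auto intro!: ring_idealI intro: generated_ideal.intros(2-5))

lemma generated_ideal_least: "ring_ideal T \<Longrightarrow> G \<subseteq> T \<Longrightarrow> generated_ideal G \<subseteq> T"
proof
  fix x assume T: "ring_ideal T" "G \<subseteq> T"
  assume "x \<in> generated_ideal G"
  then show "x \<in> T" using T
    by (induction rule: generated_ideal.induct)
      (auto simp: ideal_zero ideal_add ideal_left ideal_right)
qed

text \<open>It is enough to test generators, but with an arbitrary \<open>z\<close> in between: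
  multipliers facing the middle are absorbed by \<open>z\<close>, the outer ones by
  \<open>T\<close>.\<close>

lemma generated_ideal_mult:
  assumes T: "ring_ideal T"
    and gens: "\<And>a b z. a \<in> G \<Longrightarrow> b \<in> H \<Longrightarrow> a * z * b \<in> T"
    and "a \<in> generated_ideal G" "b \<in> generated_ideal H"
  shows "a * b \<in> T"
proof -
  have *: "a * z * b \<in> T" if "a \<in> G" for a z
    using \<open>b \<in> generated_ideal H\<close>
  proof (induction arbitrary: z rule: generated_ideal.induct)
    case (base x) then show ?case using gens that by blast
  next
    case (left x c)
    from left.IH[of "z * c"] show ?case by (simp add: mult.assoc)
  next
    case (right x c)
    from ideal_right[OF T right.IH, of z c] show ?case by (simp add: mult.assoc)
  qed (auto simp: ideal_zero[OF T] ideal_add[OF T] distrib_left)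
  have "a * z * b \<in> T" for z
    using \<open>a \<in> generated_ideal G\<close>
  proof (induction arbitrary: z rule: generated_ideal.induct)
    case (base x) then show ?case using * by blast
  next
    case (left x c)
    from ideal_left[OF T left.IH, of c z] show ?case by (simp add: mult.assoc)
  next
    case (right x c)
    from right.IH[of "c * z"] show ?case by (simp add: mult.assoc)
  qed (auto simp: ideal_zero[OF T] ideal_add[OF T] distrib_right)
  from this[of 1] show ?thesis by simp
qed

text \<open>Zero, one and scalar multiples are obtained by having all scalars among the
  generators.\<close>

inductive_set generated_algebra :: "'a::ring_1 set \<Rightarrow> 'a set" for G where
  base: "x \<in> G \<Longrightarrow> x \<in> generated_algebra G"
| add: "x \<in> generated_algebra G \<Longrightarrow> y \<in> generated_algebra G \<Longrightarrow> x + y \<in> generated_algebra G"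
| mult: "x \<in> generated_algebra G \<Longrightarrow> y \<in> generated_algebra G \<Longrightarrow> x * y \<in> generated_algebra G"

section \<open>Principal ideals and divisors of prime powers\<close>

lemma poly_ideal_principal:
  fixes N :: "'k::field poly set"
  assumes "0 \<in> N" "\<And>p r. p \<in> N \<Longrightarrow> r \<in> N \<Longrightarrow> p + r \<in> N" "\<And>p r. p \<in> N \<Longrightarrow> r * p \<in> N"
  shows "\<exists>g. \<forall>p. p \<in> N \<longleftrightarrow> g dvd p"
proof (cases "N = {0}")
  case True
  then show ?thesis by (intro exI[of _ 0]) auto
next
  case False
  with assms(1) have "\<exists>g. g \<in> N \<and> g \<noteq> 0" by auto
  \<comment> \<open>A non-zero element of least degree generates: the remainder of any member modulo
    it lies in \<open>N\<close> and has smaller degree, so it vanishes.\<close>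
  then obtain g where g: "g \<in> N" "g \<noteq> 0"
    and min: "\<And>p. p \<in> N \<Longrightarrow> p \<noteq> 0 \<Longrightarrow> degree g \<le> degree p"
    using arg_min_nat_lemma[of "\<lambda>g. g \<in> N \<and> g \<noteq> 0" _ degree] by blast
  have "g dvd p" if "p \<in> N" for p
  proof -
    have "p + (- (p div g)) * g \<in> N" using assms(2,3) g that by blast
    moreover have "p + (- (p div g)) * g = p mod g" by (simp add: minus_div_mult_eq_mod[symmetric])
    ultimately have "p mod g \<in> N" by simp
    then have "p mod g = 0"
      using min[of "p mod g"] degree_mod_less[OF g(2), of p] by fastforce
    then show ?thesis by (simp add: mod_eq_0_iff_dvd)
  qed
  then show ?thesis using assms(3) g by (intro exI[of _ g]) (auto elim!: dvdE simp: mult.commute[of g])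
qed

text \<open>No unique factorization is invoked: in g k = f^(m+1) the prime f divides g or k, and
  cancelling it leaves a divisor of f^m.\<close>

lemma dvd_prime_power_assoc:
  fixes f g :: "'a::idom"
  assumes f: "prime_elem f"
  shows "g dvd f ^ m \<Longrightarrow> \<exists>n. g dvd f ^ n \<and> f ^ n dvd g"
proof (induction m arbitrary: g)
  case 0
  then show ?case by (intro exI[of _ 0]) simp
next
  case (Suc m)
  then obtain k where k: "f * f ^ m = g * k" by (auto simp: dvd_def)
  then have "f dvd g * k" by (metis dvd_triv_left)
  then consider "f dvd g" | "f dvd k" using f prime_elem_dvd_mult_iff by blast
  then show ?case
  proof cases
    case 1
    then obtain g' where g': "g = f * g'" by (auto simp: dvd_def)
    with k have "f ^ m = g' * k" using f by (auto simp: mult.assoc prime_elem_def)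
    then obtain n where "g' dvd f ^ n" "f ^ n dvd g'" using Suc.IH[of g'] by auto
    then show ?thesis using g' by (intro exI[of _ "Suc n"]) auto
  next
    case 2
    then obtain k' where "k = f * k'" by (auto simp: dvd_def)
    with k have "f ^ m = g * k'" using f by (auto simp: mult.left_commute prime_elem_def)
    then show ?thesis using Suc.IH[of g] by auto
  qed
qed

text \<open>Modulo \<open>R\<close>, which need not be contained in the set of sums of products itself.\<close>

inductive_set ideal_product :: "'a::ring_1 set \<Rightarrow> 'a set \<Rightarrow> 'a set \<Rightarrow> 'a set" for R A B where
  base: "x \<in> R \<Longrightarrow> x \<in> ideal_product R A B"
| prod: "a \<in> A \<Longrightarrow> b \<in> B \<Longrightarrow> a * b \<in> ideal_product R A B"
| add: "x \<in> ideal_product R A B \<Longrightarrow> y \<in> ideal_product R A B \<Longrightarrow> x + y \<in> ideal_product R A B"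

lemma ring_ideal_product:
  assumes R: "ring_ideal R" and A: "ring_ideal A" and B: "ring_ideal B"
  shows "ring_ideal (ideal_product R A B)"
proof (rule ring_idealI)
  show "0 \<in> ideal_product R A B" by (rule ideal_product.base[OF ideal_zero[OF R]])
  fix x a assume x: "x \<in> ideal_product R A B"
  from x show "a * x \<in> ideal_product R A B"
  proof (induction rule: ideal_product.induct)
    case (prod c b)
    from ideal_product.prod[OF ideal_left[OF A prod(1), of a] prod(2)] show ?case
      by (simp add: mult.assoc)
  qed (auto simp: distrib_left intro: ideal_product.add ideal_product.base ideal_left[OF R])
  from x show "x * a \<in> ideal_product R A B"
  proof (induction rule: ideal_product.induct)
    case (prod c b)
    from ideal_product.prod[OF prod(1) ideal_right[OF B prod(2), of a]] show ?case
      by (simp add: mult.assoc)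
  qed (auto simp: distrib_right intro: ideal_product.add ideal_product.base ideal_right[OF R])
qed (rule ideal_product.add)

text \<open>Parallel to \<open>ideal_power\<close> in the quotient, again with exponent 1 giving
  \<open>P\<close> itself.\<close>

fun ideal_product_power :: "'a::ring_1 set \<Rightarrow> 'a set \<Rightarrow> nat \<Rightarrow> 'a set" where
  "ideal_product_power R P 0 = UNIV"
| "ideal_product_power R P (Suc 0) = P"
| "ideal_product_power R P (Suc (Suc n)) = ideal_product R (ideal_product_power R P (Suc n)) P"

section \<open>Paths in Leavitt path algebras\<close>

text \<open>Relation CK2 enters only through \<open>R\<close>: in the application it puts
  \<open>gap v (out_arcs E v)\<close> into \<open>R\<close> for each regular vertex v, hence into
  every ideal containing \<open>R\<close>. Symbols outside the graph lie in \<open>R\<close>, which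
  lets \<open>V\<close>, \<open>Ed\<close> and \<open>Gh\<close> be total functions.\<close>

locale leavitt_family = wf_digraph E for E :: "('v, 'e) pre_digraph" +
  fixes R :: "'a::ring_1 set" and scal :: "'k::field \<Rightarrow> 'a"
    and V :: "'v \<Rightarrow> 'a" and Ed Gh :: "'e \<Rightarrow> 'a"
  assumes ideal_R: "ring_ideal R"
    and scal_add: "scal (c + d) = scal c + scal d"
    and scal_mult: "scal (c * d) = scal c * scal d"
    and scal_1: "scal 1 = 1"
    and scal_central: "x * scal c = scal c * x"
    and generated: "generated_algebra (range scal \<union> range V \<union> range Ed \<union> range Gh) = UNIV"
    and V_V: "cg R (V v * V v) (V v)"
    and V_W: "v \<noteq> w \<Longrightarrow> V v * V w \<in> R"
    and V_Ed: "cg R (V (tail E e) * Ed e) (Ed e)"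
    and Ed_V: "cg R (Ed e * V (head E e)) (Ed e)"
    and V_Gh: "cg R (V (head E e) * Gh e) (Gh e)"
    and Gh_V: "cg R (Gh e * V (tail E e)) (Gh e)"
    and Gh_Ed: "e \<in> arcs E \<Longrightarrow> cg R (Gh e * Ed e) (V (head E e))"
    and Gh_Ed_ne: "e \<noteq> f \<Longrightarrow> Gh e * Ed f \<in> R"
    and V_outside: "v \<notin> verts E \<Longrightarrow> V v \<in> R"
    and Ed_outside: "e \<notin> arcs E \<Longrightarrow> Ed e \<in> R"
    and Gh_outside: "e \<notin> arcs E \<Longrightarrow> Gh e \<in> R"
begin

lemmas R_refl = cg_refl[OF ideal_R]
lemmas R_sym = cg_sym[OF ideal_R]
lemmas R_trans [trans] = cg_trans[OF ideal_R]
lemmas R_add = cg_add[OF ideal_R]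
lemmas R_diff = cg_diff[OF ideal_R]
lemmas R_left = cg_left[OF ideal_R]
lemmas R_right = cg_right[OF ideal_R]
lemmas R_mult = cg_mult[OF ideal_R]
lemmas R_sum = cg_sum[OF ideal_R]
lemmas R_0_iff = cg_0_iff[OF ideal_R]
lemmas R_mem_iff = cg_mem_iff[OF ideal_R]

lemma scal_0: "scal 0 = 0"
  using scal_add[of 0 0] by simp

lemma scal_central2: "x * (scal c * y) = scal c * (x * y)"
  by (metis scal_central mult.assoc)

lemma scal_mem_iff:
  assumes "ring_ideal T" "c \<noteq> 0"
  shows "scal c * x \<in> T \<longleftrightarrow> x \<in> T"
proof
  assume "scal c * x \<in> T"
  then have "scal (inverse c) * (scal c * x) \<in> T" using assms by (auto intro: ideal_left)
  also have "scal (inverse c) * (scal c * x) = x"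
    using assms by (simp add: mult.assoc[symmetric] scal_mult[symmetric] scal_1)
  finally show "x \<in> T" .
qed (use assms in \<open>auto intro: ideal_left\<close>)

text \<open>The empty product is 1 and not a vertex, so a walk p ending at w is represented by
  \<open>pth p * V w\<close>, and its ghost by \<open>V w * gst p\<close>.\<close>

definition pth :: "'e list \<Rightarrow> 'a" where "pth p = prod_list (map Ed p)"
definition gst :: "'e list \<Rightarrow> 'a" where "gst p = prod_list (map Gh (rev p))"

lemma pth_simps [simp]: "pth [] = 1" "pth (e # p) = Ed e * pth p" "pth (p @ p') = pth p * pth p'"
  by (simp_all add: pth_def)

lemma gst_simps [simp]: "gst [] = 1" "gst (e # p) = gst p * Gh e" "gst (p @ p') = gst p' * gst p"
  by (simp_all add: gst_def)

lemma awalk_append: "awalk u (p @ r) v \<longleftrightarrow> (\<exists>w. awalk u p w \<and> awalk w r v)"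
  by (auto simp del: awalk_append_iff intro: awalk_appendI) (auto simp: awalk_append_iff)

lemma V_pth: "awalk u p w \<Longrightarrow> cg R (V u * (pth p * V w)) (pth p * V w)"
proof (cases p)
  case (Cons e r)
  assume "awalk u p w"
  then have "u = tail E e" using Cons by (simp add: awalk_Cons_iff)
  with R_right[OF V_Ed[of e], of "pth r * V w"] Cons show ?thesis
    by (simp add: mult.assoc)
qed (auto simp: awalk_Nil_iff V_V)

lemma V_pth_ne:
  assumes "awalk u p w" "v \<noteq> u"
  shows "V v * (pth p * V w) \<in> R"
proof -
  have "cg R (V v * (pth p * V w)) (V v * (V u * (pth p * V w)))"
    by (intro R_left R_sym[OF V_pth] assms)
  moreover have "V v * V u * (pth p * V w) \<in> R"
    by (rule ideal_right[OF ideal_R V_W[OF \<open>v \<noteq> u\<close>]])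
  ultimately show ?thesis using R_mem_iff by (auto simp: mult.assoc)
qed

lemma pth_V: "awalk u p w \<Longrightarrow> p \<noteq> [] \<Longrightarrow> cg R (pth p * V w) (pth p)"
proof (induction p arbitrary: u)
  case (Cons e r)
  show ?case
  proof (cases "r = []")
    case True
    then show ?thesis using Cons.prems Ed_V[of e] by (simp add: awalk_Cons_iff awalk_Nil_iff)
  next
    case False
    then show ?thesis using Cons by (auto simp: awalk_Cons_iff mult.assoc intro: R_left)
  qed
qed simp

lemma V_pth': "awalk u p w \<Longrightarrow> p \<noteq> [] \<Longrightarrow> cg R (V u * pth p) (pth p)"
  by (cases p) (auto simp: awalk_Cons_iff mult.assoc[symmetric] intro: R_right V_Ed)

lemma gst_V: "awalk u p w \<Longrightarrow> cg R (V w * gst p * V u) (V w * gst p)"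
proof (cases p)
  case (Cons e r)
  assume "awalk u p w"
  then have "u = tail E e" using Cons by (simp add: awalk_Cons_iff)
  with R_left[OF Gh_V[of e], of "V w * gst r"] Cons show ?thesis
    by (simp add: mult.assoc)
qed (auto simp: awalk_Nil_iff V_V)

lemma Gh_pth:
  assumes "awalk u (e # p) w"
  shows "cg R (Gh e * (pth (e # p) * V w)) (pth p * V w)"
proof -
  from assms have e: "e \<in> arcs E" and p: "awalk (head E e) p w" by (auto simp: awalk_Cons_iff)
  have "cg R (Gh e * Ed e * (pth p * V w)) (V (head E e) * (pth p * V w))"
    by (intro R_right Gh_Ed e)
  also have "cg R \<dots> (pth p * V w)" by (rule V_pth[OF p])
  finally show ?thesis by (simp add: mult.assoc)
qed

lemma Gh_pth_ne: "f \<noteq> e \<Longrightarrow> Gh f * (pth (e # p) * x) \<in> R"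
  using ideal_right[OF ideal_R Gh_Ed_ne[of f e], of "pth p * x"] by (simp add: mult.assoc)

lemma gst_pth: "awalk u p w \<Longrightarrow> cg R (gst p * (pth p * V w)) (V w)"
proof (induction p arbitrary: u)
  case (Cons e p)
  have "cg R (gst p * (Gh e * (pth (e # p) * V w))) (gst p * (pth p * V w))"
    by (rule R_left[OF Gh_pth[OF Cons.prems]])
  also have "cg R \<dots> (V w)" using Cons by (auto simp: awalk_Cons_iff)
  finally show ?case by (simp add: mult.assoc)
qed (auto simp: R_refl)

section \<open>The gap idempotents\<close>

definition gap :: "'v \<Rightarrow> 'e set \<Rightarrow> 'a" where
  "gap w F = V w - (\<Sum>e\<in>F. Ed e * Gh e)"

lemma gap_empty [simp]: "gap w {} = V w"
  by (simp add: gap_def)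

context
  fixes w F assumes F: "finite F" "F \<subseteq> out_arcs E w"
begin

lemma V_gap: "cg R (V w * gap w F) (gap w F)"
  unfolding gap_def right_diff_distrib sum_distrib_left
proof (intro R_diff R_sum V_V)
  fix e assume "e \<in> F"
  then have "tail E e = w" using F by auto
  with R_right[OF V_Ed[of e], of "Gh e"] show "cg R (V w * (Ed e * Gh e)) (Ed e * Gh e)"
    by (simp add: mult.assoc)
qed

lemma gap_V: "cg R (gap w F * V w) (gap w F)"
  unfolding gap_def left_diff_distrib sum_distrib_right
proof (intro R_diff R_sum V_V)
  fix e assume "e \<in> F"
  then have "tail E e = w" using F by auto
  with R_left[OF Gh_V[of e], of "Ed e"] show "cg R (Ed e * Gh e * V w) (Ed e * Gh e)"
    by (simp add: mult.assoc)
qed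

text \<open>By CK1 only the summand with f = e acts on \<open>Ed e\<close>, and it cancels
  \<open>V w * Ed e\<close>.\<close>

lemma gap_Ed:
  assumes "e \<in> out_arcs E w"
  shows "cg R (gap w F * Ed e) (if e \<in> F then 0 else Ed e)"
proof -
  have "cg R (Ed f * Gh f * Ed e) (if f = e then Ed e else 0)" for f
  proof (cases "f = e")
    case True
    then have "cg R (Ed f * (Gh f * Ed e)) (Ed e * V (head E e))"
      using assms by (auto intro!: R_left Gh_Ed)
    also have "cg R \<dots> (Ed e)" by (rule Ed_V)
    finally show ?thesis using True by (simp add: mult.assoc)
  qed (simp add: R_0_iff mult.assoc ideal_left[OF ideal_R] Gh_Ed_ne)
  then have "cg R (\<Sum>f\<in>F. Ed f * Gh f * Ed e) (\<Sum>f\<in>F. if f = e then Ed e else 0)"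
    by (intro R_sum)
  moreover have "cg R (V w * Ed e) (Ed e)" using V_Ed[of e] assms by auto
  ultimately have "cg R (gap w F * Ed e) (Ed e - (\<Sum>f\<in>F. if f = e then Ed e else 0))"
    unfolding gap_def left_diff_distrib sum_distrib_right by (intro R_diff)
  then show ?thesis using F by (simp split: if_splits)
qed

lemma Gh_gap:
  assumes "e \<in> F"
  shows "Gh e * gap w F \<in> R"
proof -
  have "cg R (Gh e * (Ed f * Gh f)) (if f = e then Gh e else 0)" for f
  proof (cases "f = e")
    case True
    then have "cg R (Gh e * Ed f * Gh f) (V (head E e) * Gh e)"
      using assms F by (auto intro!: R_right Gh_Ed)
    also have "cg R \<dots> (Gh e)" by (rule V_Gh)
    finally show ?thesis using True by (simp add: mult.assoc)
  qed (simp add: R_0_iff mult.assoc[symmetric] ideal_right[OF ideal_R] Gh_Ed_ne)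
  then have "cg R (\<Sum>f\<in>F. Gh e * (Ed f * Gh f)) (\<Sum>f\<in>F. if f = e then Gh e else 0)"
    by (intro R_sum)
  moreover have "cg R (Gh e * V w) (Gh e)" using Gh_V[of e] assms F by auto
  ultimately have "cg R (Gh e * gap w F) (Gh e - (\<Sum>f\<in>F. if f = e then Gh e else 0))"
    unfolding gap_def right_diff_distrib sum_distrib_left by (intro R_diff)
  then show ?thesis using F assms by (simp add: R_0_iff)
qed

text \<open>\<open>gap w F\<close> annihilates the summands of \<open>gap w F'\<close> over F and
  fixes the remaining ones, so the product is \<open>gap w F\<close> minus the latter.\<close>

lemma gap_gap:
  assumes "F \<subseteq> F'" "finite F'" "F' \<subseteq> out_arcs E w"
  shows "cg R (gap w F * gap w F') (gap w F')"
proof -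
  have "cg R (gap w F * (Ed e * Gh e)) (if e \<in> F then 0 else Ed e * Gh e)" if "e \<in> F'" for e
    using R_right[OF gap_Ed[of e], of "Gh e"] that assms by (auto simp: mult.assoc)
  then have "cg R (\<Sum>e\<in>F'. gap w F * (Ed e * Gh e)) (\<Sum>e\<in>F'. if e \<in> F then 0 else Ed e * Gh e)"
    by (intro R_sum)
  then have "cg R (gap w F * gap w F') (gap w F - (\<Sum>e\<in>F'. if e \<in> F then 0 else Ed e * Gh e))"
    unfolding gap_def[of w F'] right_diff_distrib sum_distrib_left by (intro R_diff gap_V)
  also have "(\<Sum>e\<in>F'. if e \<in> F then 0 else Ed e * Gh e) = (\<Sum>e\<in>F' - F. Ed e * Gh e)"
    using assms by (auto simp: sum.If_cases Diff_eq)
  also have "gap w F - (\<Sum>e\<in>F' - F. Ed e * Gh e) = gap w F'"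
    using sum.subset_diff[OF assms(1,2), of "\<lambda>e. Ed e * Gh e"] by (simp add: gap_def)
  finally show ?thesis .
qed

lemma gap_idem: "cg R (gap w F * gap w F) (gap w F)"
  using F by (intro gap_gap) auto

end

section \<open>Polynomials in real paths\<close>

text \<open>The support \<open>A\<close> is kept apart from the coefficients because its cardinality
  and the total length of its walks are the induction measures.\<close>

definition path_poly :: "('e list \<Rightarrow> 'k) \<Rightarrow> 'e list set \<Rightarrow> 'a" where
  "path_poly k A = (\<Sum>p\<in>A. scal (k p) * pth p)"

lemma path_poly_V:
  assumes "\<And>p. p \<in> A \<Longrightarrow> awalk u p w"
  shows "cg R (V u * (path_poly k A * V w)) (path_poly k A * V w)"
  unfolding path_poly_def sum_distrib_right sum_distrib_left
  by (intro R_sum) (auto simp: mult.assoc scal_central2 intro!: R_left V_pth assms)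

text \<open>CK1 turns left multiplication by a ghost edge into deletion of a first edge: walks
  beginning with f lose it, all others vanish.\<close>

lemma Gh_path_poly:
  assumes "finite A" and A: "\<And>p. p \<in> A \<Longrightarrow> p \<noteq> [] \<and> awalk u p w"
  shows "cg R (Gh f * (path_poly k A * V w)) (path_poly (\<lambda>p. k (f # p)) {p. f # p \<in> A} * V w)"
proof -
  let ?g = "\<lambda>p. scal (k p) * (pth (tl p) * V w)"
  have "cg R (Gh f * (scal (k p) * pth p * V w)) (if hd p = f then ?g p else 0)" if "p \<in> A" for p
  proof -
    from A[OF that] obtain e p' where p: "p = e # p'" "awalk u (e # p') w" by (cases p) auto
    have "cg R (Gh f * (pth p * V w)) (if hd p = f then pth (tl p) * V w else 0)"
      using p Gh_pth[of u f p' w] Gh_pth_ne[of f e p' "V w"] by (auto simp: R_0_iff simp del: pth_simps)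
    from R_left[OF this, of "scal (k p)"] show ?thesis
      by (auto simp: mult.assoc scal_central2 split: if_splits)
  qed
  then have "cg R (\<Sum>p\<in>A. Gh f * (scal (k p) * pth p * V w)) (\<Sum>p\<in>A. if hd p = f then ?g p else 0)"
    by (intro R_sum)
  also have "(\<Sum>p\<in>A. if hd p = f then ?g p else 0) = (\<Sum>p\<in>A \<inter> {p. hd p = f}. ?g p)"
    using \<open>finite A\<close> by (simp add: sum.If_cases)
  also have "\<dots> = (\<Sum>p\<in>{p. f # p \<in> A}. ?g (f # p))"
  proof -
    have "f # tl p = p" if "p \<in> A" "hd p = f" for p
      using A[OF that(1)] that(2) by (cases p) auto
    then show ?thesis
      by (intro sum.reindex_bij_witness[of _ "Cons f" tl]) auto
  qed
  finally show ?thesis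
    by (simp add: path_poly_def sum_distrib_left sum_distrib_right mult.assoc)
qed

text \<open>The walk p @ [e] inherits the coefficient of p, whence \<open>butlast\<close>.\<close>

lemma path_poly_Ed:
  assumes "e \<in> out_arcs E w"
  shows "cg R (path_poly k A * V w * Ed e) (path_poly (\<lambda>p. k (butlast p)) ((\<lambda>p. p @ [e]) ` A) * V (head E e))"
proof -
  have "cg R (V w * Ed e) (Ed e * V (head E e))"
    using V_Ed[of e] R_sym[OF Ed_V[of e]] assms by (auto intro: R_trans)
  then have "cg R (path_poly k A * (V w * Ed e)) (path_poly k A * (Ed e * V (head E e)))"
    by (rule R_left)
  also have "path_poly k A * Ed e = path_poly (\<lambda>p. k (butlast p)) ((\<lambda>p. p @ [e]) ` A)"
    by (simp add: path_poly_def sum.reindex inj_on_def sum_distrib_right mult.assoc)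
  then have "path_poly k A * (Ed e * V (head E e)) =
      path_poly (\<lambda>p. k (butlast p)) ((\<lambda>p. p @ [e]) ` A) * V (head E e)"
    by (simp add: mult.assoc[symmetric])
  finally show ?thesis by (simp add: mult.assoc)
qed

section \<open>Polynomials in closed walks and their rotations\<close>

definition closed_walks :: "'v \<Rightarrow> 'e list set \<Rightarrow> bool" where
  "closed_walks w A \<longleftrightarrow> finite A \<and> (\<forall>p\<in>A. p \<noteq> [] \<and> awalk w p w)"

text \<open>The words f^{-1} p e for those p in \<open>A\<close> that begin with f. For f = e each
  such closed walk is turned by one edge.\<close>

definition rotations :: "'e \<Rightarrow> 'e \<Rightarrow> 'e list set \<Rightarrow> 'e list set" where
  "rotations f e A = {p. f # p \<in> (\<lambda>p. p @ [e]) ` A}"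

definition cpoly :: "'k \<Rightarrow> ('e list \<Rightarrow> 'k) \<Rightarrow> 'e list set \<Rightarrow> 'v \<Rightarrow> 'a" where
  "cpoly c k A w = (scal c + path_poly k A) * V w"

lemma hd_closed: "closed_walks w A \<Longrightarrow> hd ` A \<subseteq> out_arcs E w"
  by (auto simp: closed_walks_def neq_Nil_conv awalk_Cons_iff)

text \<open>Deleting f loses the walks with another first edge. The resulting drop in cardinality,
  stated last, drives the induction.\<close>

lemma rotations:
  assumes "closed_walks w A" "f \<in> out_arcs E w" "e \<in> out_arcs E w"
  shows "finite (rotations f e A)" "card (rotations f e A) \<le> card A"
    and "p \<in> rotations f e A \<Longrightarrow> p \<noteq> [] \<and> awalk (head E f) p (head E e)"
    and "p \<in> A \<Longrightarrow> hd p \<noteq> f \<Longrightarrow> card (rotations f e A) < card A"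
proof -
  have A: "finite A" using assms by (simp add: closed_walks_def)
  let ?A = "{p \<in> A. hd p = f}"
  have im: "rotations f e A \<subseteq> (\<lambda>p. tl p @ [e]) ` ?A"
  proof
    fix p assume "p \<in> rotations f e A"
    then obtain r where r: "r \<in> A" "f # p = r @ [e]" by (auto simp: rotations_def)
    with assms have "r \<noteq> []" by (auto simp: closed_walks_def)
    with r have "p = tl r @ [e]" "hd r = f" by (auto simp: neq_Nil_conv)
    with r show "p \<in> (\<lambda>p. tl p @ [e]) ` ?A" by auto
  qed
  with A show "finite (rotations f e A)" by (simp add: finite_subset)
  have le: "card (rotations f e A) \<le> card ?A"
    using surj_card_le[OF _ im] A by simp
  also have "\<dots> \<le> card A" using A by (intro card_mono) auto
  finally show "card (rotations f e A) \<le> card A" .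
  show "p \<noteq> [] \<and> awalk (head E f) p (head E e)" if "p \<in> rotations f e A" for p
  proof -
    from im that obtain r where r: "r \<in> A" "hd r = f" "p = tl r @ [e]" by auto
    with assms have "r = f # tl r" "awalk w r w" by (auto simp: closed_walks_def)
    then have "awalk (head E f) (tl r) w" by (metis awalk_Cons_iff)
    then show ?thesis using r assms by (auto intro!: awalk_appendI simp: awalk_Cons_iff awalk_Nil_iff)
  qed
  show "card (rotations f e A) < card A" if "p \<in> A" "hd p \<noteq> f"
  proof -
    have "card ?A < card A" using that A by (intro psubset_card_mono) auto
    with le show ?thesis by simp
  qed
qed

lemma V_cpoly: "closed_walks w A \<Longrightarrow> cg R (V w * cpoly c k A w) (cpoly c k A w)"
  unfolding cpoly_def distrib_left distrib_right
  by (intro R_add path_poly_V) (auto simp: scal_central2 closed_walks_def intro!: R_left V_V)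

lemma cpoly_V: "cg R (cpoly c k A w * V w) (cpoly c k A w)"
  by (simp add: cpoly_def mult.assoc R_left V_V)

text \<open>Every walk of \<open>A\<close> starts with an edge of \<open>F\<close>, which the gap
  annihilates, so only the constant term survives.\<close>

lemma gap_cpoly:
  assumes A: "closed_walks w A" and F: "finite F" "F \<subseteq> out_arcs E w" "hd ` A \<subseteq> F"
  shows "cg R (gap w F * cpoly c k A w) (scal c * gap w F)"
proof -
  have "gap w F * (scal (k p) * pth p * V w) \<in> R" if "p \<in> A" for p
  proof -
    from A that obtain e p' where p: "p = e # p'" by (auto simp: closed_walks_def neq_Nil_conv)
    with F that have "e \<in> F" by force
    with gap_Ed[of F w e] F have "gap w F * Ed e \<in> R" by (auto simp: R_0_iff)
    then have "scal (k p) * (gap w F * Ed e * (pth p' * V w)) \<in> R"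
      by (rule ideal_left[OF ideal_R ideal_right[OF ideal_R]])
    then show ?thesis using p by (simp add: mult.assoc scal_central2)
  qed
  then have "(\<Sum>p\<in>A. gap w F * (scal (k p) * pth p * V w)) \<in> R"
    by (intro ideal_sum[OF ideal_R])
  then have "cg R (gap w F * (path_poly k A * V w)) 0"
    by (simp add: path_poly_def sum_distrib_left sum_distrib_right R_0_iff)
  moreover have "cg R (scal c * (gap w F * V w)) (scal c * gap w F)"
    using F by (intro R_left gap_V)
  ultimately have "cg R (scal c * (gap w F * V w) + gap w F * (path_poly k A * V w)) (scal c * gap w F + 0)"
    by (intro R_add)
  then show ?thesis by (simp add: cpoly_def distrib_left distrib_right scal_central2)
qed

text \<open>The walks are rotated, while the constant term meets \<open>Gh f * Ed e\<close> and by
  CK1 survives only for f = e.\<close>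

lemma Gh_cpoly_Ed:
  assumes A: "closed_walks w A" and f: "f \<in> out_arcs E w" and e: "e \<in> out_arcs E w"
  shows "cg R (Gh f * (cpoly c k A w * Ed e))
    (cpoly (if f = e then c else 0) (\<lambda>p. k (butlast (f # p))) (rotations f e A) (head E e))"
proof -
  let ?A = "(\<lambda>p. p @ [e]) ` A"
  have "cg R (Gh f * (path_poly k A * V w * Ed e)) (Gh f * (path_poly (\<lambda>p. k (butlast p)) ?A * V (head E e)))"
    by (rule R_left[OF path_poly_Ed[OF e]])
  also have "cg R \<dots> (path_poly (\<lambda>p. k (butlast (f # p))) {p. f # p \<in> ?A} * V (head E e))"
    using A e by (intro Gh_path_poly[where u = w])
      (auto simp: closed_walks_def awalk_Cons_iff awalk_Nil_iff intro!: awalk_appendI)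
  finally have 1: "cg R (Gh f * (path_poly k A * V w * Ed e))
      (path_poly (\<lambda>p. k (butlast (f # p))) (rotations f e A) * V (head E e))"
    by (simp add: rotations_def)
  have "cg R (Gh f * (V w * Ed e)) (Gh f * Ed e)"
    using V_Ed[of e] e by (intro R_left) auto
  also have "cg R \<dots> (scal (if f = e then 1 else 0) * V (head E e))"
    using Gh_Ed[of f] Gh_Ed_ne[of f e] f by (auto simp: scal_0 scal_1 R_0_iff)
  finally have "cg R (scal c * (Gh f * (V w * Ed e)))
      (scal c * (scal (if f = e then 1 else 0) * V (head E e)))"
    by (rule R_left)
  then have 2: "cg R (scal c * (Gh f * (V w * Ed e))) (scal (if f = e then c else 0) * V (head E e))"
    by (auto simp: scal_0 scal_1)
  from R_add[OF 2 1] show ?thesis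
    unfolding cpoly_def by (simp add: distrib_left distrib_right mult.assoc scal_central2)
qed

text \<open>Modulo \<open>P\<close> the source of each edge e of the walk equals
  \<open>Ed e * Gh e\<close>, so every other edge with that source lies in \<open>P\<close>: the
  walk has no exits in the quotient.\<close>

definition exitless :: "'a set \<Rightarrow> 'e list \<Rightarrow> bool" where
  "exitless P p \<longleftrightarrow> (\<forall>e\<in>set p. gap (tail E e) {e} \<in> P)"

text \<open>The induction hypothesis of \<open>path_poly_transfer\<close> on the number of terms,
  named so that the steps can be separate lemmas.\<close>

definition real_polys_transfer :: "'a set \<Rightarrow> 'a set \<Rightarrow> nat \<Rightarrow> bool" where
  "real_polys_transfer P T n \<longleftrightarrow>
    (\<forall>u w k A F. card A < n \<longrightarrow> finite A \<longrightarrow> (\<forall>p\<in>A. awalk u p w) \<longrightarrow>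
      finite F \<longrightarrow> F \<subseteq> out_arcs E w \<longrightarrow> path_poly k A * gap w F \<in> P \<longrightarrow> path_poly k A * gap w F \<in> T)"

section \<open>Moving polynomials in real paths from \<open>P\<close> to \<open>T\<close>\<close>

context
  fixes P T :: "'a set"
  assumes P: "ring_ideal P" "R \<subseteq> P" and T: "ring_ideal T" "R \<subseteq> T"
    and gaps: "\<And>w F. finite F \<Longrightarrow> F \<subseteq> out_arcs E w \<Longrightarrow> gap w F \<in> P \<Longrightarrow> gap w F \<in> T"
    and cycles: "\<And>u p x. awalk u p u \<Longrightarrow> p \<noteq> [] \<Longrightarrow> exitless P p \<Longrightarrow> x \<in> P \<Longrightarrow>
      V u * x * V u \<in> T"
begin

lemma mem_P_iff: "cg R x y \<Longrightarrow> x \<in> P \<longleftrightarrow> y \<in> P"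
  using cg_mem_iff[OF P(1) cg_mono[OF _ P(2)]] .

lemma mem_T_iff: "cg R x y \<Longrightarrow> x \<in> T \<longleftrightarrow> y \<in> T"
  using cg_mem_iff[OF T(1) cg_mono[OF _ T(2)]] .

text \<open>The conjugate has fewer than n terms: for distinct f and e the constant term disappears,
  and for f = e some walk of \<open>A\<close> does not begin with f and is lost.\<close>

lemma transfer_rotation:
  assumes small: "real_polys_transfer P T n"
    and A: "closed_walks w A" "Suc (card A) \<le> n"
    and fe: "f \<in> out_arcs E w" "e \<in> out_arcs E w" "f \<noteq> e \<or> (\<exists>p\<in>A. hd p \<noteq> f)"
    and inP: "Gh f * (cpoly c k A w * Ed e) \<in> P"
  shows "Gh f * (cpoly c k A w * Ed e) \<in> T"
proof -
  let ?B = "rotations f e A" and ?k = "\<lambda>p. k (butlast (f # p))" and ?c = "if f = e then c else 0"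
  note B = rotations[OF A(1) fe(1,2)]
  note cg = Gh_cpoly_Ed[OF A(1) fe(1,2), of c k]
  have inP': "cpoly ?c ?k ?B (head E e) \<in> P" using inP mem_P_iff[OF cg] by simp
  have "cpoly ?c ?k ?B (head E e) \<in> T"
  proof (cases "f = e")
    case False
    then have *: "cpoly ?c ?k ?B (head E e) = path_poly ?k ?B * gap (head E e) {}"
      by (simp add: cpoly_def scal_0)
    have "card ?B < n" using B(2) A(2) by simp
    then show ?thesis
      using small B(1,3) inP' unfolding real_polys_transfer_def *
      by (metis empty_subsetI finite.emptyI)
  next
    case True
    \<comment> \<open>The constant term is counted as the empty walk with coefficient c.\<close>
    define B' where "B' = insert [] ?B"
    have "[] \<notin> ?B" using B(3) by blast
    then have "path_poly (?k([] := c)) B' = scal c + path_poly ?k ?B"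
      using B(1) unfolding path_poly_def B'_def
      by (simp add: sum.insert, intro sum.cong) auto
    then have *: "cpoly ?c ?k ?B (head E e) = path_poly (?k([] := c)) B' * gap (head E e) {}"
      using True by (simp add: cpoly_def)
    have "card B' < n"
      using B(1,4) fe(3) True A(2) \<open>[] \<notin> ?B\<close> unfolding B'_def by fastforce
    moreover have "finite B'" "\<forall>p\<in>B'. awalk (head E e) p (head E e)"
      using B(1,3) True fe by (auto simp: B'_def awalk_Nil_iff)
    ultimately show ?thesis
      using small inP' unfolding real_polys_transfer_def *
      by (metis empty_subsetI finite.emptyI)
  qed
  then show ?thesis using mem_T_iff[OF cg] by simp
qed

text \<open>Multiplying by the smaller gap on both sides wipes out the closed walks on the left and
  absorbs \<open>gap w F\<close> on the right. What remains is a non-zero scalar times an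
  idempotent.\<close>

lemma gap_mem:
  assumes A: "closed_walks w A" and "c \<noteq> 0" and F: "finite F" "F \<subseteq> out_arcs E w"
    and inP: "cpoly c k A w * gap w F \<in> P"
  shows "gap w (F \<union> hd ` A) \<in> P"
proof -
  let ?F = "F \<union> hd ` A"
  have F': "finite ?F" "?F \<subseteq> out_arcs E w"
    using F A hd_closed[OF A] by (auto simp: closed_walks_def)
  have "gap w ?F * (cpoly c k A w * gap w F) * gap w ?F \<in> P"
    by (intro ideal_left[OF P(1)] ideal_right[OF P(1)] inP)
  moreover have "cg R (gap w ?F * cpoly c k A w * (gap w F * gap w ?F)) (scal c * gap w ?F * gap w ?F)"
    using F F' A by (intro R_mult gap_cpoly gap_gap) auto
  moreover have "cg R (scal c * (gap w ?F * gap w ?F)) (scal c * gap w ?F)"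
    using F' by (intro R_left gap_idem)
  ultimately have "scal c * gap w ?F \<in> P"
    using mem_P_iff by (simp add: mult.assoc)
  then show ?thesis using scal_mem_iff[OF P(1) \<open>c \<noteq> 0\<close>] by simp
qed

lemma Gh_cpoly_Ed_mem:
  assumes F: "finite F" "F \<subseteq> out_arcs E w" "e \<in> out_arcs E w - F"
    and inP: "cpoly c k A w * gap w F \<in> P"
  shows "Gh f * (cpoly c k A w * Ed e) \<in> P"
proof -
  have "cg R (cpoly c k A w * (gap w F * Ed e)) (cpoly c k A w * Ed e)"
    using gap_Ed[of F w e] F by (intro R_left) auto
  then have "cpoly c k A w * Ed e \<in> P"
    using mem_P_iff ideal_right[OF P(1) inP, of "Ed e"] by (simp add: mult.assoc)
  then show ?thesis by (rule ideal_left[OF P(1)])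
qed

text \<open>Split w on the left and \<open>gap w F\<close> on the right by means of the gap over
  \<open>F\<close> and all first edges of \<open>A\<close>. This gap is in \<open>T\<close> by
  \<open>gap_mem\<close>, and the other summands contain the conjugates of
  \<open>step\<close>.\<close>

lemma cpoly_transfer:
  assumes A: "closed_walks w A" and "c \<noteq> 0" and F: "finite F" "F \<subseteq> out_arcs E w"
    and inP: "cpoly c k A w * gap w F \<in> P"
    and step: "\<And>f e. f \<in> F \<union> hd ` A \<Longrightarrow> e \<in> hd ` A - F \<Longrightarrow> Gh f * (cpoly c k A w * Ed e) \<in> T"
  shows "cpoly c k A w * gap w F \<in> T"
proof -
  let ?F = "F \<union> hd ` A" and ?Y = "cpoly c k A w"
  have F': "finite ?F" "?F \<subseteq> out_arcs E w"
    using F A hd_closed[OF A] by (auto simp: closed_walks_def)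
  have gap: "gap w ?F \<in> T"
    using gaps[OF F' gap_mem[OF A \<open>c \<noteq> 0\<close> F inP]] .
  have Ed: "?Y * Ed e \<in> T" if "e \<in> hd ` A - F" for e
  proof -
    have "gap w ?F * (?Y * Ed e) + (\<Sum>f\<in>?F. Ed f * (Gh f * (?Y * Ed e))) \<in> T"
      using that by (intro ideal_add[OF T(1)] ideal_sum[OF T(1)] ideal_right[OF T(1) gap]
          ideal_left[OF T(1)] step) auto
    also have "gap w ?F * (?Y * Ed e) + (\<Sum>f\<in>?F. Ed f * (Gh f * (?Y * Ed e))) = V w * ?Y * Ed e"
      by (simp add: gap_def left_diff_distrib sum_distrib_right mult.assoc)
    finally show ?thesis
      using mem_T_iff[OF R_right[OF V_cpoly[OF A]]] by blast
  qed
  have "?Y * gap w ?F + (\<Sum>e\<in>?F - F. ?Y * Ed e * Gh e) \<in> T"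
    by (intro ideal_add[OF T(1)] ideal_sum[OF T(1)] ideal_left[OF T(1) gap] ideal_right[OF T(1)] Ed)
      auto
  also have "?Y * gap w ?F + (\<Sum>e\<in>?F - F. ?Y * Ed e * Gh e) = ?Y * (gap w ?F + (\<Sum>e\<in>?F - F. Ed e * Gh e))"
    by (simp add: distrib_left sum_distrib_left mult.assoc)
  also have "gap w ?F + (\<Sum>e\<in>?F - F. Ed e * Gh e) = gap w F"
    using sum.subset_diff[of F ?F "\<lambda>e. Ed e * Gh e"] F' by (simp add: gap_def)
  finally show ?thesis .
qed

text \<open>Conjugating by the first edge of \<open>p\<close> rotates all walks of \<open>A\<close> at once; either this cancels
  some of them, or, after a full turn, \<open>p\<close> has been seen to have no exit.\<close>

lemma cpoly_transfer_rotate: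
  assumes small: "real_polys_transfer P T n"
  shows "closed_walks w A \<Longrightarrow> Suc (card A) \<le> n \<Longrightarrow> c \<noteq> 0 \<Longrightarrow> cpoly c k A w \<in> P \<Longrightarrow>
    p @ p' \<in> A \<Longrightarrow> exitless P p' \<Longrightarrow> cpoly c k A w \<in> T"
proof (induction p arbitrary: w k A p')
  case Nil
  \<comment> \<open>The turn is complete: the whole closed walk p' at w is exitless, so
    \<open>cycles\<close> applies.\<close>
  then have "V w * cpoly c k A w * V w \<in> T"
    by (intro cycles[of w p']) (auto simp: closed_walks_def)
  moreover have "cg R (V w * cpoly c k A w * V w) (cpoly c k A w)"
    using R_right[OF V_cpoly] cpoly_V R_trans Nil by blast
  ultimately show ?case using mem_T_iff by blast
next
  case (Cons e p)
  let ?Y = "cpoly c k A w"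
  have inP: "?Y * gap w {} \<in> P" using ideal_right[OF P(1)] Cons.prems by simp
  have "?Y * gap w {} \<in> T"
  proof (rule cpoly_transfer[OF Cons.prems(1,3) _ _ inP])
    fix f g assume fg: "f \<in> {} \<union> hd ` A" "g \<in> hd ` A - {}"
    note hd = hd_closed[OF Cons.prems(1)]
    from fg hd have fg': "f \<in> out_arcs E w" "g \<in> out_arcs E w" by auto
    have m: "Gh f * (?Y * Ed g) \<in> P"
      by (rule Gh_cpoly_Ed_mem[OF _ _ _ inP]) (use fg' in auto)
    show "Gh f * (?Y * Ed g) \<in> T"
    proof (cases "f \<noteq> g \<or> (\<exists>p\<in>A. hd p \<noteq> f)")
      case True
      then show ?thesis by (rule transfer_rotation[OF small Cons.prems(1,2) fg' _ m])
    next
      case False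
      \<comment> \<open>Here every walk of \<open>A\<close> begins with e. Then
        \<open>gap_mem\<close> with empty F shows that e has no exit modulo \<open>P\<close>, and e
        passes from the front of the walk to its exitless tail.\<close>
      with Cons.prems(5) have fe: "f = e" "g = e" by force+
      with False Cons.prems(5) have "hd ` A = {e}" by force
      then have "gap w {e} \<in> P"
        using gap_mem[OF Cons.prems(1,3) _ _ inP] by simp
      moreover have "tail E e = w" using fg' fe by auto
      ultimately have ex: "exitless P (p' @ [e])"
        using Cons.prems(6) by (auto simp: exitless_def)
      let ?B = "rotations e e A"
      note B = rotations[OF Cons.prems(1) fg'[unfolded fe]]
      note cg = Gh_cpoly_Ed[OF Cons.prems(1) fg'[unfolded fe], of c k, simplified]
      have "cpoly c (\<lambda>p. k (butlast (e # p))) ?B (head E e) \<in> T"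
      proof (rule Cons.IH[OF _ _ Cons.prems(3) _ _ ex])
        show "closed_walks (head E e) ?B" using B by (auto simp: closed_walks_def)
        show "Suc (card ?B) \<le> n" using B(2) Cons.prems(2) by simp
        show "cpoly c (\<lambda>p. k (butlast (e # p))) ?B (head E e) \<in> P"
          using m mem_P_iff[OF cg] fe by simp
        show "p @ p' @ [e] \<in> ?B" using Cons.prems(5) by (auto simp: rotations_def image_iff)
      qed
      then show ?thesis using mem_T_iff[OF cg] fe by simp
    qed
  qed auto
  then show ?case using mem_T_iff[OF cpoly_V] by simp
qed

text \<open>Conjugation removes \<open>gap w F\<close>, because e lies outside \<open>F\<close>. If
  the number of terms does not drop, the rotated polynomial has no gap factor and
  \<open>cpoly_transfer_rotate\<close> applies to it.\<close>

lemma cpoly_gap_transfer: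
  assumes small: "real_polys_transfer P T n"
    and A: "closed_walks w A" "Suc (card A) \<le> n" and "c \<noteq> 0"
    and F: "finite F" "F \<subseteq> out_arcs E w"
    and inP: "cpoly c k A w * gap w F \<in> P"
  shows "cpoly c k A w * gap w F \<in> T"
proof (rule cpoly_transfer[OF A(1) \<open>c \<noteq> 0\<close> F inP])
  fix f e assume fe: "f \<in> F \<union> hd ` A" "e \<in> hd ` A - F"
  with F hd_closed[OF A(1)] have fe': "f \<in> out_arcs E w" "e \<in> out_arcs E w" by auto
  have m: "Gh f * (cpoly c k A w * Ed e) \<in> P"
    by (rule Gh_cpoly_Ed_mem[OF F _ inP]) (use fe fe' in auto)
  show "Gh f * (cpoly c k A w * Ed e) \<in> T"
  proof (cases "f \<noteq> e \<or> (\<exists>p\<in>A. hd p \<noteq> f)")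
    case True
    then show ?thesis by (rule transfer_rotation[OF small A fe' _ m])
  next
    case False
    then have [simp]: "f = e" by simp
    let ?B = "rotations e e A"
    note B = rotations[OF A(1) fe'(2,2)]
    note cg = Gh_cpoly_Ed[OF A(1) fe'(2,2), of c k, simplified]
    from fe obtain p where p: "p \<in> A" "hd p = e" by auto
    with A have "p = e # tl p" by (auto simp: closed_walks_def)
    with p have "tl p @ [e] \<in> ?B" by (auto simp: rotations_def image_iff intro!: bexI[of _ p])
    then have "cpoly c (\<lambda>p. k (butlast (e # p))) ?B (head E e) \<in> T"
      using cpoly_transfer_rotate[OF small, of "head E e" ?B c _ "tl p @ [e]" "[]"]
        B A \<open>c \<noteq> 0\<close> m mem_P_iff[OF cg]
      by (auto simp: closed_walks_def exitless_def)
    then show ?thesis using mem_T_iff[OF cg] by simp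
  qed
qed

text \<open>Outer induction on the number of walks, inner induction on their total length. If the
  empty walk occurs with non-zero coefficient, the polynomial has the form treated in
  \<open>cpoly_gap_transfer\<close>. If it does not occur, splitting u over the first edges and
  stripping these lowers the total length.\<close>

lemma path_poly_transfer:
  "card A \<le> n \<Longrightarrow> finite A \<Longrightarrow> (\<And>p. p \<in> A \<Longrightarrow> awalk u p w) \<Longrightarrow>
    finite F \<Longrightarrow> F \<subseteq> out_arcs E w \<Longrightarrow> path_poly k A * gap w F \<in> P \<Longrightarrow> path_poly k A * gap w F \<in> T"
proof (induction n arbitrary: u k A w F rule: less_induct)
  case (less n)
  have small: "real_polys_transfer P T n"
    unfolding real_polys_transfer_def using less.IH by (meson le_refl)
  have "path_poly k A * gap w F \<in> T"
    if "(\<Sum>p\<in>A. length p) = m" "card A \<le> n" "finite A" "\<And>p. p \<in> A \<Longrightarrow> awalk u p w"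
      "finite F" "F \<subseteq> out_arcs E w" "path_poly k A * gap w F \<in> P" for m u w k A F
    using that
  proof (induction m arbitrary: u w k A F rule: less_induct)
    case (less m)
    note F = less.prems(5,6)
    have cgV: "cg R (x * V w * gap w F) (x * gap w F)" for x
      using R_left[OF V_gap[OF F], of x] by (simp add: mult.assoc)
    show ?case
    proof (cases "[] \<in> A")
      case True
      let ?A = "A - {[]}"
      have card: "Suc (card ?A) \<le> n"
        using less.prems(2,3) True by (metis card.remove)
      have path_poly: "path_poly k A = scal (k []) + path_poly k ?A"
        using less.prems(3) True by (simp add: path_poly_def sum.remove)
      \<comment> \<open>The empty walk joins u to w, so all other walks are closed and its
        coefficient is the constant term.\<close>
      have "u = w" using less.prems(4)[OF True] by (simp add: awalk_Nil_iff)
      show ?thesis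
      proof (cases "k [] = 0")
        case True
        then have "path_poly k A = path_poly k ?A" using path_poly by (simp add: scal_0)
        then show ?thesis
          using small card less.prems(3-7) unfolding real_polys_transfer_def
          by (metis DiffD1 Suc_le_lessD finite_Diff)
      next
        case False
        have "closed_walks w ?A" using less.prems(3,4) \<open>u = w\<close> by (auto simp: closed_walks_def)
        moreover have "cg R (cpoly (k []) k ?A w * gap w F) (path_poly k A * gap w F)"
          using cgV by (simp add: cpoly_def path_poly)
        ultimately show ?thesis
          using cpoly_gap_transfer[OF small _ card False F] mem_P_iff mem_T_iff less.prems(7) by blast
      qed
    next
      case False
      then have ne: "p \<noteq> []" if "p \<in> A" for p using that by auto
      have Gh: "Gh e * (path_poly k A * gap w F) \<in> T" if e: "e \<in> hd ` A" for e
      proof -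
        let ?B = "{p. e # p \<in> A}"
        have B: "finite ?B" using finite_vimageI[OF less.prems(3), of "Cons e"]
          by (simp add: vimage_def)
        have im: "Cons e ` ?B \<subseteq> A" by auto
        have c: "card ?B \<le> n"
          using card_mono[OF less.prems(3) im] less.prems(2) by (simp add: card_image)
        from e obtain p where "e # p \<in> A" using ne by (metis imageE list.collapse)
        \<comment> \<open>Every stripped walk is shorter by one, and there is at least one because e
          is a first edge, so the inequality is strict.\<close>
        then have "(\<Sum>p\<in>?B. length p) < (\<Sum>p\<in>?B. length (e # p))"
          using B by (intro sum_strict_mono) auto
        also have "\<dots> = (\<Sum>p\<in>Cons e ` ?B. length p)" by (simp add: sum.reindex)
        also have "\<dots> \<le> m"
          using less.prems(1) sum_mono2[OF less.prems(3) im, of length] by simp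
        finally have lt: "(\<Sum>p\<in>?B. length p) < m" .
        have "cg R (Gh e * (path_poly k A * V w) * gap w F)
            (path_poly (\<lambda>p. k (e # p)) ?B * V w * gap w F)"
          using less.prems(3,4) ne by (intro R_right Gh_path_poly[of _ u]) auto
        also have "cg R \<dots> (path_poly (\<lambda>p. k (e # p)) ?B * gap w F)" by (rule cgV)
        finally have cg: "cg R (Gh e * (path_poly k A * V w * gap w F)) \<dots>" by (simp add: mult.assoc)
        have cg: "cg R (Gh e * (path_poly k A * gap w F)) (path_poly (\<lambda>p. k (e # p)) ?B * gap w F)"
          using R_trans[OF R_sym[OF R_left[OF cgV]] cg] .
        have "path_poly (\<lambda>p. k (e # p)) ?B * gap w F \<in> P"
          using mem_P_iff[OF cg] ideal_left[OF P(1) less.prems(7)] by blast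
        moreover have "awalk (head E e) p w" if "p \<in> ?B" for p
          using less.prems(4)[of "e # p"] that by (simp add: awalk_Cons_iff)
        ultimately have "path_poly (\<lambda>p. k (e # p)) ?B * gap w F \<in> T"
          using less.IH[OF lt refl c B _ F] by blast
        then show ?thesis using mem_T_iff[OF cg] by blast
      qed
      \<comment> \<open>The gap over all first edges annihilates every walk of \<open>A\<close>, so
        after splitting u only the stripped polynomials matter.\<close>
      let ?F = "hd ` A"
      have "gap u ?F * Ed e \<in> R" if "e \<in> ?F" for e
      proof -
        have "?F \<subseteq> out_arcs E u"
          using less.prems(4) ne by (force simp: neq_Nil_conv awalk_Cons_iff)
        with gap_Ed[of ?F u e] that less.prems(3) show ?thesis by (auto simp: R_0_iff)
      qed
      then have "gap u ?F * (scal (k p) * pth p * V w) \<in> R" if "p \<in> A" for p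
        using ne[OF that] that
          ideal_left[OF ideal_R ideal_right[OF ideal_R], of "gap u ?F * Ed (hd p)" "scal (k p)" "pth (tl p) * V w"]
        by (cases p) (force simp: mult.assoc scal_central2)+
      then have "(\<Sum>p\<in>A. gap u ?F * (scal (k p) * pth p * V w)) \<in> R"
        by (intro ideal_sum[OF ideal_R])
      then have "gap u ?F * (path_poly k A * V w) \<in> R"
        by (simp add: path_poly_def sum_distrib_left sum_distrib_right)
      then have "gap u ?F * (path_poly k A * V w) * gap w F \<in> T"
        using T by (auto intro: ideal_right)
      moreover have "cg R (gap u ?F * (path_poly k A * V w * gap w F)) (gap u ?F * (path_poly k A * gap w F))"
        by (intro R_left cgV)
      ultimately have "gap u ?F * (path_poly k A * gap w F) \<in> T"
        using mem_T_iff by (simp add: mult.assoc)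
      then have "gap u ?F * (path_poly k A * gap w F) + (\<Sum>e\<in>?F. Ed e * (Gh e * (path_poly k A * gap w F))) \<in> T"
        using Gh by (intro ideal_add[OF T(1) _ ideal_sum[OF T(1) ideal_left[OF T(1)]]])
      then have "V u * (path_poly k A * gap w F) \<in> T"
        by (simp add: gap_def left_diff_distrib sum_distrib_right mult.assoc)
      moreover have "cg R (path_poly k A * gap w F) (V u * (path_poly k A * gap w F))"
      proof -
        have "cg R (path_poly k A * gap w F) (path_poly k A * V w * gap w F)" by (rule R_sym[OF cgV])
        also have "cg R \<dots> (V u * (path_poly k A * V w) * gap w F)"
          using less.prems(4) by (intro R_sym[OF R_right[OF path_poly_V]])
        also have "V u * (path_poly k A * V w) * gap w F = V u * (path_poly k A * V w * gap w F)"
          by (simp add: mult.assoc)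
        also have "cg R \<dots> (V u * (path_poly k A * gap w F))" by (rule R_left[OF cgV])
        finally show ?thesis .
      qed
      ultimately show ?thesis using mem_T_iff by blast
    qed
  qed
  with less.prems show ?case by blast
qed

end

section \<open>Ideals are determined by gaps and exitless cycles\<close>

text \<open>Combinations of monomials p q^* from u to v modulo \<open>R\<close>. Only the ghost part
  is bounded, as its length is the induction measure in \<open>ideal_transfer\<close>.\<close>

inductive_set walk_span :: "'v \<Rightarrow> 'v \<Rightarrow> nat \<Rightarrow> 'a set" for u v N where
  base: "x \<in> R \<Longrightarrow> x \<in> walk_span u v N"
| add: "x \<in> walk_span u v N \<Longrightarrow> y \<in> walk_span u v N \<Longrightarrow> x + y \<in> walk_span u v N"
| walks: "awalk u p w \<Longrightarrow> awalk v p' w \<Longrightarrow> length p' \<le> N \<Longrightarrow>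
    scal c * (pth p * (V w * gst p')) \<in> walk_span u v N"

lemma walk_span_cg: "y \<in> walk_span u v N \<Longrightarrow> cg R x y \<Longrightarrow> x \<in> walk_span u v N"
  using walk_span.add[OF walk_span.base[of "x - y" u v N], of y] by (simp add: cg_def)

lemma walk_span_mono: "x \<in> walk_span u v N \<Longrightarrow> N \<le> M \<Longrightarrow> x \<in> walk_span u v M"
  by (induction rule: walk_span.induct) (auto intro: walk_span.intros)

lemma walk_span_V: "x \<in> walk_span u v N \<Longrightarrow> cg R (x * V v) x"
proof (induction rule: walk_span.induct)
  case (base x)
  then show ?case unfolding cg_def by (intro ideal_diff[OF ideal_R] ideal_right[OF ideal_R])
next
  case (walks p w p' c)
  from R_left[OF gst_V[OF walks(2)], of "scal c * pth p"] show ?case by (simp add: mult.assoc)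
qed (auto simp: distrib_right intro: R_add)

lemma walk_span_0_path_poly:
  assumes "x \<in> walk_span u v 0"
  shows "\<exists>k A. finite A \<and> (\<forall>p\<in>A. awalk u p v) \<and> cg R x (path_poly k A * V v)"
  using assms
proof (induction rule: walk_span.induct)
  case (base x)
  then show ?case by (intro exI[of _ "\<lambda>_. 0"] exI[of _ "{}"]) (simp add: path_poly_def R_0_iff)
next
  case (add x y)
  then obtain k A l B where A: "finite A" "\<forall>p\<in>A. awalk u p v" "cg R x (path_poly k A * V v)"
    and B: "finite B" "\<forall>p\<in>B. awalk u p v" "cg R y (path_poly l B * V v)" by auto
  \<comment> \<open>The supports may overlap, so coefficients are extended by 0 and added.\<close>
  let ?m = "\<lambda>p. (if p \<in> A then k p else 0) + (if p \<in> B then l p else 0)"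
  have "path_poly ?m (A \<union> B) = (\<Sum>p\<in>A \<union> B. if p \<in> A then scal (k p) * pth p else 0) +
      (\<Sum>p\<in>A \<union> B. if p \<in> B then scal (l p) * pth p else 0)"
    unfolding path_poly_def sum.distrib[symmetric]
    by (intro sum.cong) (auto simp: scal_add scal_0 distrib_right)
  also have "\<dots> = path_poly k A + path_poly l B"
    using A B unfolding path_poly_def by (intro arg_cong2[where f = "(+)"] sum.mono_neutral_cong_right) auto
  finally have "cg R (x + y) (path_poly ?m (A \<union> B) * V v)"
    using R_add[OF A(3) B(3)] by (simp add: distrib_right)
  then show ?case using A B by (intro exI[of _ ?m] exI[of _ "A \<union> B"]) auto
next
  case (walks p w p' c)
  then have "p' = []" "w = v" by (auto simp: awalk_Nil_iff)
  then show ?case using walks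
    by (intro exI[of _ "\<lambda>_. c"] exI[of _ "{p}"]) (simp add: path_poly_def R_refl mult.assoc)
qed

text \<open>The edge cancels the last ghost factor by CK1, or annihilates the monomial, or prolongs
  a monomial without ghosts. In each case the bound may be lowered by one.\<close>

lemma walk_span_Ed:
  assumes "x \<in> walk_span u v (Suc N)" "e \<in> out_arcs E v"
  shows "x * Ed e \<in> walk_span u (head E e) N"
  using assms(1)
proof (induction rule: walk_span.induct)
  case (walks p w p' c)
  show ?case
  proof (cases p')
    case Nil
    then have [simp]: "w = v" using walks by (auto simp: awalk_Nil_iff)
    have "awalk u (p @ [e]) (head E e)"
      using walks assms(2) by (auto intro!: awalk_appendI simp: awalk_Cons_iff awalk_Nil_iff)
    then have "scal c * (pth (p @ [e]) * (V (head E e) * gst [])) \<in> walk_span u (head E e) N"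
      using assms(2) by (intro walk_span.walks) (auto simp: awalk_Nil_iff)
    moreover have "cg R (V v * Ed e) (Ed e * V (head E e))"
      using V_Ed[of e] R_sym[OF Ed_V[of e]] assms by (auto intro: R_trans)
    then have "cg R (scal c * pth p * (V v * Ed e)) (scal c * pth p * (Ed e * V (head E e)))"
      by (rule R_left)
    ultimately show ?thesis using Nil by (simp add: mult.assoc) (erule (1) walk_span_cg)
  next
    case (Cons f r)
    show ?thesis
    proof (cases "f = e")
      case True
      with walks Cons have r: "awalk (head E e) r w" by (auto simp: awalk_Cons_iff)
      have "cg R (V w * gst r * (Gh e * Ed e)) (V w * gst r * V (head E e))"
        using assms by (intro R_left Gh_Ed) auto
      also have "cg R \<dots> (V w * gst r)" by (rule gst_V[OF r])
      finally have "cg R (scal c * pth p * (V w * gst r * (Gh e * Ed e))) (scal c * pth p * (V w * gst r))"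
        by (rule R_left)
      moreover have "scal c * (pth p * (V w * gst r)) \<in> walk_span u (head E e) N"
        using walks Cons r by (intro walk_span.walks) auto
      ultimately show ?thesis using Cons True by (simp add: mult.assoc) (erule (1) walk_span_cg)
    next
      case False
      from ideal_left[OF ideal_R Gh_Ed_ne[OF this], of "scal c * (pth p * (V w * gst r))"]
      show ?thesis using Cons by (intro walk_span.base) (simp add: mult.assoc)
    qed
  qed
qed (auto simp: distrib_right intro: walk_span.intros ideal_right[OF ideal_R])

text \<open>By \<open>Gh_gap\<close> a gap over enough edges kills every monomial with a ghost part,
  leaving the real part y. Allowing all larger \<open>F'\<close> lets two summands share a
  union.\<close>

lemma walk_span_gap:
  assumes "x \<in> walk_span u v N"
  shows "\<exists>F y. finite F \<and> F \<subseteq> out_arcs E v \<and> y \<in> walk_span u v 0 \<and>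
    (\<forall>F'. F \<subseteq> F' \<longrightarrow> finite F' \<longrightarrow> F' \<subseteq> out_arcs E v \<longrightarrow> cg R (x * gap v F') (y * gap v F'))"
  using assms
proof (induction rule: walk_span.induct)
  case (base x)
  then show ?case by (intro exI[of _ "{}"] exI[of _ x]) (auto intro: walk_span.base R_refl)
next
  case (add x y)
  from add.IH(1) obtain F x' where F: "finite F" "F \<subseteq> out_arcs E v" "x' \<in> walk_span u v 0"
    and x: "\<And>G. F \<subseteq> G \<Longrightarrow> finite G \<Longrightarrow> G \<subseteq> out_arcs E v \<Longrightarrow> cg R (x * gap v G) (x' * gap v G)"
    by auto
  from add.IH(2) obtain F' y' where F': "finite F'" "F' \<subseteq> out_arcs E v" "y' \<in> walk_span u v 0"
    and y: "\<And>G. F' \<subseteq> G \<Longrightarrow> finite G \<Longrightarrow> G \<subseteq> out_arcs E v \<Longrightarrow> cg R (y * gap v G) (y' * gap v G)"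
    by auto
  show ?case
  proof (intro exI[of _ "F \<union> F'"] exI[of _ "x' + y'"] conjI allI impI)
    show "x' + y' \<in> walk_span u v 0" using F(3) F'(3) by (rule walk_span.add)
    fix G assume "F \<union> F' \<subseteq> G" "finite G" "G \<subseteq> out_arcs E v"
    then show "cg R ((x + y) * gap v G) ((x' + y') * gap v G)"
      unfolding distrib_right by (intro R_add x y) auto
  qed (use F F' in auto)
next
  case (walks p w p' c)
  show ?case
  proof (cases p')
    case Nil
    then have "scal c * (pth p * (V w * gst p')) \<in> walk_span u v 0"
      using walks by (intro walk_span.walks) auto
    then show ?thesis
      by (intro exI[of _ "{}"] exI[of _ "scal c * (pth p * (V w * gst p'))"]) (auto intro: R_refl)
  next
    case (Cons f r)
    then have f: "f \<in> out_arcs E v" using walks by (auto simp: awalk_Cons_iff)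
    have "scal c * (pth p * (V w * gst p')) * gap v F \<in> R"
      if "{f} \<subseteq> F" "finite F" "F \<subseteq> out_arcs E v" for F
      using ideal_left[OF ideal_R Gh_gap[of F v f], of "scal c * (pth p * (V w * gst r))"] that Cons
      by (simp add: mult.assoc)
    then show ?thesis using f
      by (intro exI[of _ "{f}"] exI[of _ 0])
        (auto simp: R_0_iff intro: walk_span.base ideal_zero[OF ideal_R])
  qed
qed

text \<open>Modulo \<open>R\<close> this is the left ideal generated by \<open>V v\<close>. The
  starting vertex is left free so that arbitrary elements can act from the left.\<close>

inductive_set spans :: "'v \<Rightarrow> 'a set" for v where
  base: "x \<in> R \<Longrightarrow> x \<in> spans v"
| add: "x \<in> spans v \<Longrightarrow> y \<in> spans v \<Longrightarrow> x + y \<in> spans v"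
| walks: "awalk u p w \<Longrightarrow> awalk v p' w \<Longrightarrow> scal c * (pth p * (V w * gst p')) \<in> spans v"

lemma spans_cg: "y \<in> spans v \<Longrightarrow> cg R x y \<Longrightarrow> x \<in> spans v"
  using spans.add[OF spans.base[of "x - y" v], of y] by (simp add: cg_def)

lemma spans_scal: "x \<in> spans v \<Longrightarrow> scal c * x \<in> spans v"
proof (induction rule: spans.induct)
  case (walks u p w p' d)
  then have "scal (c * d) * (pth p * (V w * gst p')) \<in> spans v"
    by (rule spans.walks)
  then show ?case by (simp add: scal_mult mult.assoc)
qed (auto simp: distrib_left intro: spans.intros ideal_left[OF ideal_R])

text \<open>Up to elements of \<open>R\<close>, the monomials p q^* are stable under generators: the
  vertex u acts as identity, a composable edge prolongs p, and a ghost edge cancels by CK1 or, when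
  p is empty, prolongs q.\<close>

lemma gen_spans:
  assumes "a \<in> range scal \<union> range V \<union> range Ed \<union> range Gh"
    and p: "awalk u p w" and p': "awalk v p' w"
  shows "a * (pth p * (V w * gst p')) \<in> spans v"
proof -
  let ?m = "pth p * (V w * gst p')"
  have m: "?m \<in> spans v" using spans.walks[OF p p', of 1] by (simp add: scal_1)
  have Vm: "cg R (V u * ?m) ?m"
    using R_right[OF V_pth[OF p], of "gst p'"] by (simp add: mult.assoc)
  have Vm_ne: "V u' * ?m \<in> R" if "u' \<noteq> u" for u'
    using ideal_right[OF ideal_R V_pth_ne[OF p that], of "gst p'"] by (simp add: mult.assoc)
  from assms(1) consider c where "a = scal c" | u' where "a = V u'" | e where "a = Ed e"
    | e where "a = Gh e" by auto
  then show ?thesis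
  proof cases
    case (1 c)
    then show ?thesis using spans.walks[OF p p'] by simp
  next
    case (2 u')
    then show ?thesis
      using spans_cg[OF m Vm] spans.base[OF Vm_ne] by (cases "u' = u") auto
  next
    case (3 e)
    consider "e \<notin> arcs E" | "e \<in> arcs E" "head E e = u" | "head E e \<noteq> u" by blast
    then show ?thesis
    proof cases
      case 1
      then show ?thesis using 3 by (auto intro: spans.base ideal_right[OF ideal_R] Ed_outside)
    next
      case 2
      then have "awalk (tail E e) (e # p) w" using p by (simp add: awalk_Cons_iff)
      from spans.walks[OF this p', of 1] show ?thesis
        using 3 by (simp add: scal_1 mult.assoc)
    next
      case c: 3
      have "Ed e * (V (head E e) * ?m) \<in> R" by (rule ideal_left[OF ideal_R Vm_ne[OF c]])
      moreover have "cg R (Ed e * V (head E e) * ?m) (Ed e * ?m)" by (rule R_right[OF Ed_V])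
      ultimately show ?thesis using R_mem_iff 3 by (auto simp: mult.assoc intro: spans.base)
    qed
  next
    case (4 e)
    show ?thesis
    proof (cases "e \<in> arcs E")
      case False
      then show ?thesis using 4 by (auto intro: spans.base ideal_right[OF ideal_R] Gh_outside)
    next
      case e: True
      show ?thesis
      proof (cases p)
        case Nil
        then have [simp]: "u = w" using p by (simp add: awalk_Nil_iff)
        show ?thesis
        proof (cases "tail E e = w")
          case True
          then have "awalk v (p' @ [e]) (head E e)"
            using p' e by (auto intro!: awalk_appendI simp: awalk_Cons_iff awalk_Nil_iff)
          moreover have "awalk (head E e) [] (head E e)" using e by (simp add: awalk_Nil_iff)
          ultimately have "1 * (pth [] * (V (head E e) * gst (p' @ [e]))) \<in> spans v"
            using spans.walks[of "head E e" "[]" "head E e" v "p' @ [e]" 1] by (simp add: scal_1)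
          moreover have "cg R (Gh e * V w) (V (head E e) * Gh e)"
            using R_trans[OF Gh_V[of e] R_sym[OF V_Gh[of e]]] True by simp
          then have "cg R (Gh e * V w * gst p') (V (head E e) * Gh e * gst p')" by (rule R_right)
          ultimately show ?thesis using 4 Nil by (simp add: mult.assoc) (erule (1) spans_cg)
        next
          case False
          have "cg R (Gh e * V (tail E e) * (V w * gst p')) (Gh e * (V w * gst p'))"
            by (rule R_right[OF Gh_V])
          moreover have "Gh e * (V (tail E e) * V w * gst p') \<in> R"
            by (rule ideal_left[OF ideal_R ideal_right[OF ideal_R V_W[OF False]]])
          ultimately show ?thesis using R_mem_iff 4 Nil by (auto simp: mult.assoc intro: spans.base)
        qed
      next
        case (Cons f r)
        show ?thesis
        proof (cases "f = e")
          case True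
          then have "awalk (head E e) r w" using p Cons by (simp add: awalk_Cons_iff)
          from spans.walks[OF this p', of 1] have "pth r * (V w * gst p') \<in> spans v"
            by (simp add: scal_1)
          moreover have "cg R (Gh e * (pth (e # r) * V w) * gst p') (pth r * V w * gst p')"
            using p Cons True by (intro R_right Gh_pth) auto
          ultimately show ?thesis using 4 Cons True by (simp add: mult.assoc) (erule (1) spans_cg)
        next
          case False
          with Gh_pth_ne[of e f r "V w * gst p'"] Cons 4 show ?thesis
            by (auto simp: mult.assoc intro: spans.base)
        qed
      qed
    qed
  qed
qed

lemma spans_left:
  assumes "x \<in> spans v"
  shows "a * x \<in> spans v"
proof -
  have "a \<in> generated_algebra (range scal \<union> range V \<union> range Ed \<union> range Gh)"
    by (simp add: generated)
  then show ?thesis using assms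
  proof (induction arbitrary: x rule: generated_algebra.induct)
    case (base a)
    from base(2) show ?case
    proof (induction rule: spans.induct)
      case (walks u p w p' c)
      from spans_scal[OF gen_spans[OF base(1) walks], of c] show ?case
        by (simp add: scal_central2)
    qed (auto simp: distrib_left intro: spans.intros ideal_left[OF ideal_R])
  qed (auto simp: distrib_right mult.assoc intro: spans.intros)
qed

lemma V_spans: "x \<in> spans v \<Longrightarrow> \<exists>N. V u * x \<in> walk_span u v N"
proof (induction rule: spans.induct)
  case (add x y)
  then obtain N M where "V u * x \<in> walk_span u v N" "V u * y \<in> walk_span u v M" by auto
  then show ?case
    by (intro exI[of _ "max N M"]) (simp add: distrib_left, intro walk_span.add; erule walk_span_mono; simp)
next
  case (walks u' p w p' c)
  show ?case
  proof (cases "u' = u")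
    case True
    from walks True have "scal c * (pth p * (V w * gst p')) \<in> walk_span u v (length p')"
      by (intro walk_span.walks) auto
    moreover have "cg R (scal c * (V u * (pth p * V w) * gst p')) (scal c * ((pth p * V w) * gst p'))"
      using walks True by (intro R_left R_right V_pth) auto
    ultimately show ?thesis
      by (intro exI[of _ "length p'"], simp add: mult.assoc scal_central2) (erule (1) walk_span_cg)
  next
    case False
    from ideal_left[OF ideal_R ideal_right[OF ideal_R V_pth_ne[OF walks(1), of u]], of "scal c" "gst p'"] False
    show ?thesis by (auto simp: mult.assoc scal_central2 intro: walk_span.base)
  qed
qed (auto intro: walk_span.base ideal_left[OF ideal_R])

lemma corner_walk_span: "\<exists>N. V u * a * V v \<in> walk_span u v N"
proof -
  have "V v \<in> spans v"
  proof (cases "v \<in> verts E")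
    case True
    then have "awalk v [] v" by (simp add: awalk_Nil_iff)
    from spans.walks[OF this this, of 1] show ?thesis by (simp add: scal_1)
  qed (auto intro: spans.base V_outside)
  from V_spans[OF spans_left[OF this]] show ?thesis by (simp add: mult.assoc)
qed

text \<open>A substitute for an identity, available for elements without constant term. It writes x
  modulo \<open>R\<close> as a finite sum of corners \<open>V u * x * V v\<close>.\<close>

definition local_units :: "'a set \<Rightarrow> bool" where
  "local_units P \<longleftrightarrow> (\<forall>x\<in>P. \<exists>S. finite S \<and> cg R x ((\<Sum>v\<in>S. V v) * x * (\<Sum>v\<in>S. V v)))"

text \<open>Local units reduce the claim to corners, where one inducts on the ghost length. With F
  from \<open>walk_span_gap\<close>, x is the sum of \<open>x * gap v F\<close>, a real polynomial
  times a gap, and of terms \<open>x * Ed e * Gh e\<close> in which \<open>x * Ed e\<close> has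
  shorter ghosts.\<close>

theorem ideal_transfer:
  fixes P T :: "'a set"
  assumes P: "ring_ideal P" "R \<subseteq> P" "local_units P" and T: "ring_ideal T" "R \<subseteq> T"
    and gaps: "\<And>w F. finite F \<Longrightarrow> F \<subseteq> out_arcs E w \<Longrightarrow> gap w F \<in> P \<Longrightarrow> gap w F \<in> T"
    and cycles: "\<And>u p x. awalk u p u \<Longrightarrow> p \<noteq> [] \<Longrightarrow> exitless P p \<Longrightarrow> x \<in> P \<Longrightarrow>
      V u * x * V u \<in> T"
  shows "P \<subseteq> T"
proof
  note P_iff = cg_mem_iff[OF P(1) cg_mono[OF _ P(2)]]
  note T_iff = cg_mem_iff[OF T(1) cg_mono[OF _ T(2)]]
  have real: "y * gap v F \<in> T"
    if "y \<in> walk_span u v 0" "y * gap v F \<in> P" "finite F" "F \<subseteq> out_arcs E v" for u v y F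
  proof -
    from walk_span_0_path_poly[OF that(1)] obtain k A where A: "finite A" "\<And>p. p \<in> A \<Longrightarrow> awalk u p v"
      "cg R y (path_poly k A * V v)" by auto
    have "cg R (y * gap v F) (path_poly k A * V v * gap v F)" by (rule R_right[OF A(3)])
    also have "cg R \<dots> (path_poly k A * gap v F)"
      using R_left[OF V_gap[OF that(3,4)], of "path_poly k A"] by (simp add: mult.assoc)
    finally have cg: "cg R (y * gap v F) (path_poly k A * gap v F)" .
    then have "path_poly k A * gap v F \<in> P" using P_iff that by blast
    then have "path_poly k A * gap v F \<in> T"
      by (rule path_poly_transfer[OF P(1,2) T _ _ le_refl A(1) _ that(3,4), rotated 3])
        (erule (2) gaps, erule (3) cycles, erule A(2))
    then show ?thesis using cg T_iff by blast
  qed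
  have span: "x \<in> P \<Longrightarrow> x \<in> walk_span u v N \<Longrightarrow> x \<in> T" for x u v N
  proof (induction N arbitrary: x v)
    case 0
    have "cg R (x * gap v {}) x" using walk_span_V[OF 0(2)] by simp
    moreover have "x * gap v {} \<in> P" using 0 by (intro ideal_right[OF P(1)])
    ultimately show ?case using real[OF 0(2), of "{}"] T_iff by blast
  next
    case (Suc N)
    from walk_span_gap[OF Suc.prems(2)] obtain F y where F: "finite F" "F \<subseteq> out_arcs E v"
      and y: "y \<in> walk_span u v 0" "cg R (x * gap v F) (y * gap v F)" by blast
    have "y * gap v F \<in> P" using y(2) P_iff ideal_right[OF P(1) Suc.prems(1)] by blast
    then have 1: "x * gap v F \<in> T" using real[OF y(1) _ F] y(2) T_iff by blast
    have "x * Ed e \<in> T" if "e \<in> F" for e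
      using Suc.IH[OF ideal_right[OF P(1) Suc.prems(1)] walk_span_Ed[OF Suc.prems(2)]] that F by auto
    then have "(\<Sum>e\<in>F. x * Ed e * Gh e) \<in> T" by (rule ideal_sum[OF T(1) ideal_right[OF T(1)]])
    with 1 have "x * gap v F + (\<Sum>e\<in>F. x * Ed e * Gh e) \<in> T" by (rule ideal_add[OF T(1)])
    also have "x * gap v F + (\<Sum>e\<in>F. x * Ed e * Gh e) = x * V v"
      by (simp add: gap_def right_diff_distrib sum_distrib_left mult.assoc)
    finally show ?case using walk_span_V[OF Suc.prems(2)] T_iff by blast
  qed
  fix x assume x: "x \<in> P"
  then obtain S where S: "finite S" "cg R x ((\<Sum>v\<in>S. V v) * x * (\<Sum>v\<in>S. V v))"
    using P(3) by (auto simp: local_units_def)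
  have "V u * x * V v \<in> T" for u v
    using corner_walk_span[of u x v] span ideal_left[OF P(1) x] ideal_right[OF P(1)] by blast
  then have "(\<Sum>u\<in>S. \<Sum>v\<in>S. V u * x * V v) \<in> T" by (intro ideal_sum[OF T(1)])
  also have "(\<Sum>u\<in>S. \<Sum>v\<in>S. V u * x * V v) = (\<Sum>v\<in>S. V v) * x * (\<Sum>v\<in>S. V v)"
    by (simp add: sum_distrib_left sum_distrib_right) (rule sum.swap)
  finally show "x \<in> T" using S(2) T_iff by blast
qed

section \<open>The corner at an exitless cycle\<close>

lemma gap_singleton: "gap (tail E e) {e} \<in> J \<longleftrightarrow> cg J (V (tail E e)) (Ed e * Gh e)"
  by (simp add: gap_def cg_def)

text \<open>Consequently a gap with some positive power in an ideal containing \<open>R\<close> lies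
  in that ideal.\<close>

lemma gap_power: "finite F \<Longrightarrow> F \<subseteq> out_arcs E w \<Longrightarrow> cg R (gap w F ^ Suc m) (gap w F)"
proof (induction m)
  case (Suc m)
  have "cg R (gap w F * gap w F ^ Suc m) (gap w F * gap w F)" by (intro R_left Suc.IH Suc.prems)
  also have "cg R \<dots> (gap w F)" by (rule gap_idem[OF Suc.prems])
  finally show ?case by simp
qed (simp add: R_refl)

definition gap_gens :: "'a set \<Rightarrow> 'a set" where
  "gap_gens P = R \<union> {gap w F |w F. finite F \<and> F \<subseteq> out_arcs E w \<and> gap w F \<in> P}"

lemma gap_gensI: "finite F \<Longrightarrow> F \<subseteq> out_arcs E w \<Longrightarrow> gap w F \<in> P \<Longrightarrow> gap w F \<in> gap_gens P"
  by (auto simp: gap_gens_def)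

text \<open>Some monomial p q^* of x lies outside \<open>P\<close>, and then so does the vertex
  where p and q meet. This converts primeness into walks between vertices.\<close>

lemma walk_span_mem:
  assumes "ring_ideal P" "R \<subseteq> P" "x \<in> walk_span u v N" "x \<notin> P"
  shows "\<exists>p w p'. awalk u p w \<and> awalk v p' w \<and> V w \<notin> P"
proof (rule ccontr)
  assume no: "\<not> ?thesis"
  from assms(3) have "x \<in> P"
  proof (induction rule: walk_span.induct)
    case (walks p w p' c)
    then have "V w \<in> P" using no by blast
    then show ?case
      by (intro ideal_left[OF assms(1)] ideal_right[OF assms(1)])
  qed (use assms in \<open>auto intro: ideal_add\<close>)
  with assms(4) show False by simp
qed

context
  fixes J :: "'a set"
  assumes J: "ring_ideal J" "R \<subseteq> J"
begin

lemma mem_J_iff: "cg R x y \<Longrightarrow> x \<in> J \<longleftrightarrow> y \<in> J"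
  using cg_mem_iff[OF J(1) cg_mono[OF _ J(2)]] .

lemmas J_trans [trans] = cg_trans[OF J(1)]

text \<open>Along an exitless walk each \<open>Ed e * Gh e\<close> collapses to a vertex modulo
  \<open>J\<close>, so the ghost is a right inverse of the path; \<open>gst_pth\<close> is the other
  side.\<close>

lemma exitless_unit: "awalk u p w \<Longrightarrow> exitless J p \<Longrightarrow> cg J (pth p * (V w * gst p)) (V u)"
proof (induction p arbitrary: u)
  case Nil
  then show ?case by (auto simp: awalk_Nil_iff cg_refl[OF J(1)])
next
  case (Cons e p)
  from Cons.prems have p: "awalk (head E e) p w" "exitless J p" "u = tail E e"
    by (auto simp: awalk_Cons_iff exitless_def)
  have "cg J (Ed e * (pth p * (V w * gst p)) * Gh e) (Ed e * V (head E e) * Gh e)"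
    by (intro cg_right[OF J(1)] cg_left[OF J(1)] Cons.IH p)
  also have "cg J \<dots> (Ed e * Gh e)"
    using cg_mono[OF R_right[OF Ed_V] J(2)] .
  also have "cg J \<dots> (V u)"
    using Cons.prems(2) cg_sym[OF J(1)] by (auto simp: exitless_def gap_singleton p)
  finally show ?case using J(1) by (simp add: mult.assoc)
qed

lemma V_head_mem: "e \<in> arcs E \<Longrightarrow> Ed e \<in> J \<Longrightarrow> V (head E e) \<in> J"
  using mem_J_iff[OF Gh_Ed] ideal_left[OF J(1)] by blast

lemma awalk_power: "awalk u d u \<Longrightarrow> awalk u (concat (replicate m d)) u"
  by (induction m) (auto simp: awalk_Nil_iff intro: awalk_appendI)

text \<open>An exitless closed walk can only be left into \<open>J\<close>: an edge other than the
  next one of d lies in \<open>J\<close>, and with it its range.\<close>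

lemma exitless_prefix:
  assumes d: "awalk u d u" "d \<noteq> []" "exitless J d"
  shows "awalk u p x \<Longrightarrow> V x \<notin> J \<Longrightarrow> \<exists>m r. p @ r = concat (replicate m d)"
proof (induction p arbitrary: x rule: rev_induct)
  case Nil
  show ?case by (intro exI[of _ 0] exI[of _ "[]"]) simp
next
  case (snoc e p)
  from snoc.prems(1) have e: "e \<in> arcs E" "head E e = x" "awalk u p (tail E e)"
    unfolding awalk_append by (auto simp: awalk_Cons_iff awalk_Nil_iff)
  have Ed: "Ed e \<notin> J" using V_head_mem[OF e(1)] e(2) snoc.prems(2) by auto
  then have "V (tail E e) \<notin> J"
    using mem_J_iff[OF V_Ed] ideal_right[OF J(1)] by blast
  from snoc.IH[OF e(3) this] obtain m r where "p @ r = concat (replicate m d)" by blast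
  \<comment> \<open>Appending a further copy of d provides a next edge e' even when r is
    empty.\<close>
  then have "p @ (r @ d) = concat (replicate m d @ [d])" by simp
  then have pr: "p @ (r @ d) = concat (replicate (Suc m) d)"
    unfolding replicate_append_same by simp
  then obtain e' r' where r': "r @ d = e' # r'" using d(2) by (cases "r @ d") auto
  have "awalk u (p @ (e' # r')) u" using awalk_power[OF d(1), of "Suc m"] pr r' by simp
  then obtain y where y: "awalk u p y" "awalk y (e' # r') u" unfolding awalk_append by blast
  have "y = tail E e"
    using awalk_ends[OF y(1) e(3)] by auto
  then have e': "e' \<in> out_arcs E (tail E e)" using y by (auto simp: awalk_Cons_iff)
  have "e' \<in> set (concat (replicate (Suc m) d))" using pr r' by (metis in_set_conv_decomp)
  then have "e' \<in> set d" by (auto simp: set_concat split: if_splits)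
  then have gap: "gap (tail E e) {e'} \<in> J" using d(3) e' by (auto simp: exitless_def)
  have "e' = e"
  proof (rule ccontr)
    assume "e' \<noteq> e"
    with gap_Ed[of "{e'}" "tail E e" e] e' e(1) have "cg R (gap (tail E e) {e'} * Ed e) (Ed e)" by auto
    then show False using mem_J_iff ideal_right[OF J(1) gap] Ed by blast
  qed
  with pr r' have "(p @ [e]) @ r' = concat (replicate (Suc m) d)" by simp
  then show ?case by blast
qed

section \<open>Laurent polynomials in a shortest closed walk\<close>

context
  fixes u d
  assumes d: "awalk u d u" "d \<noteq> []" "exitless J d" and u: "V u \<notin> J"
    and shortest: "\<forall>p. awalk u p u \<longrightarrow> p \<noteq> [] \<longrightarrow> length d \<le> length p"
begin

text \<open>A closed walk at u is a prefix of a power of d. As d is shortest, it is empty or begins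
  with d, and the rest is again closed at u.\<close>

lemma closed_walk_power: "awalk u p u \<Longrightarrow> \<exists>j. p = concat (replicate j d)"
proof (induction "length p" arbitrary: p rule: less_induct)
  case less
  show ?case
  proof (cases "p = []")
    case True
    then show ?thesis by (intro exI[of _ 0]) simp
  next
    case False
    from exitless_prefix[OF d less.prems u] obtain m r
      where r: "p @ r = concat (replicate m d)" by blast
    with False have "m \<noteq> 0" by (intro notI) simp
    then obtain m' where m: "m = Suc m'" by (auto simp: gr0_conv_Suc)
    with r have "take (length d) (p @ r) = d" by simp
    with shortest less.prems False have "take (length d) p = d" by simp
    then obtain p' where p': "p = d @ p'" by (metis append_take_drop_id)
    obtain w where "awalk u d w" "awalk w p' u"
      using less.prems[unfolded p' awalk_append] by blast
    with d have "awalk u p' u" using awalk_ends[of u d w u u] by auto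
    with less.hyps[of p'] p' d(2) obtain j where "p' = concat (replicate j d)" by auto
    then show ?thesis using p' by (intro exI[of _ "Suc j"]) simp
  qed
qed

abbreviation (input) "D \<equiv> pth d"

text \<open>Evaluation at \<open>D\<close> by Horner's rule. The coefficients lie in the field and
  act through \<open>scal\<close>, so \<open>poly\<close> does not apply.\<close>

definition ev :: "'k poly \<Rightarrow> 'a" where
  "ev p = fold_coeffs (\<lambda>c x. scal c + D * x) p 0"

lemma ev_0 [simp]: "ev 0 = 0"
  by (simp add: ev_def)

lemma ev_pCons [simp]: "ev (pCons c p) = scal c + D * ev p"
  by (cases "p = 0 \<and> c = 0") (auto simp: ev_def scal_0)

lemma ev_add: "ev (p + r) = ev p + ev r"
  by (induction p r rule: poly_induct2) (simp_all add: scal_add algebra_simps)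

lemma ev_smult: "ev (smult c p) = scal c * ev p"
  by (induction p) (simp_all add: scal_mult scal_central2 distrib_left)

lemma ev_mult: "ev (p * r) = ev p * ev r"
  by (induction p) (simp_all add: ev_add ev_smult scal_0 algebra_simps)

lemma ev_X_power: "ev ([:0, 1:] ^ j) = D ^ j"
  by (induction j) (simp_all add: ev_mult scal_0 scal_1 one_pCons)

lemma ev_1: "ev 1 = 1"
  by (simp add: one_pCons scal_1)

lemma pth_power: "pth (concat (replicate m d)) = D ^ m"
  by (induction m) simp_all

lemma V_D: "cg R (V u * D) (D * V u)"
  using V_pth'[OF d(1,2)] R_sym[OF pth_V[OF d(1,2)]] by (rule R_trans)

lemma V_ev: "cg R (V u * ev p) (ev p * V u)"
proof (induction p)
  case (pCons c p)
  have "cg R (V u * D * ev p) (D * V u * ev p)" by (rule R_right[OF V_D])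
  also have "cg R (D * V u * ev p) (D * (ev p * V u))"
    using R_left[OF pCons.IH, of D] by (simp add: mult.assoc)
  finally have "cg R (scal c * V u + V u * D * ev p) (scal c * V u + D * (ev p * V u))"
    by (intro R_add R_refl)
  then show ?case by (simp add: algebra_simps scal_central)
qed (simp add: R_refl)

lemma V_ev_V: "cg R (V u * ev p * V u) (ev p * V u)"
proof -
  have "cg R (V u * ev p * V u) (ev p * V u * V u)" by (rule R_right[OF V_ev])
  also have "cg R \<dots> (ev p * V u)" using R_left[OF V_V] by (simp add: mult.assoc)
  finally show ?thesis .
qed

text \<open>Modulo \<open>J\<close> the elements of the corner are Laurent polynomials in
  \<open>D\<close>; a power of \<open>D\<close> on the right clears the negative exponents.\<close>

lemma corner_walk_ev:
  "x \<in> walk_span u u N \<Longrightarrow> \<exists>p m. cg J (x * D ^ m * V u) (ev p * V u)"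
proof (induction rule: walk_span.induct)
  case (base x)
  then have "x \<in> J" using J by blast
  then show ?case
    by (intro exI[of _ 0]) (auto simp: cg_0_iff[OF J(1)] ideal_right[OF J(1)])
next
  case (add x y)
  then obtain p m r n where xy: "cg J (x * D ^ m * V u) (ev p * V u)"
    "cg J (y * D ^ n * V u) (ev r * V u)" by blast
  \<comment> \<open>Brings the two summands to a common exponent.\<close>
  have shift: "cg J (z * D ^ (i + j) * V u) (ev (s * [:0, 1:] ^ j) * V u)"
    if "cg J (z * D ^ i * V u) (ev s * V u)" for z s i j
  proof -
    have V: "cg J (D ^ j * V u) (V u * D ^ j * V u)"
      using cg_mono[OF R_sym[OF V_ev_V] J(2)] by (simp add: ev_X_power[symmetric])
    have "cg J (z * D ^ i * (D ^ j * V u)) (z * D ^ i * (V u * D ^ j * V u))"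
      by (rule cg_left[OF J(1) V])
    also have "z * D ^ i * (V u * D ^ j * V u) = z * D ^ i * V u * (D ^ j * V u)"
      by (simp add: mult.assoc)
    also have "cg J \<dots> (ev s * V u * (D ^ j * V u))" by (rule cg_right[OF J(1) that])
    also have "ev s * V u * (D ^ j * V u) = ev s * (V u * D ^ j * V u)" by (simp add: mult.assoc)
    also have "cg J \<dots> (ev s * (D ^ j * V u))" by (rule cg_left[OF J(1) cg_sym[OF J(1) V]])
    finally show ?thesis
      using J(1) by (simp add: ev_mult ev_X_power power_add mult.assoc)
  qed
  have "cg J (x * D ^ (m + n) * V u + y * D ^ (m + n) * V u)
      (ev (p * [:0, 1:] ^ n) * V u + ev (r * [:0, 1:] ^ m) * V u)"
    using shift[OF xy(1), of n] shift[OF xy(2), of m]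
    by (intro cg_add[OF J(1)]) (simp_all add: add.commute)
  then show ?case
    by (intro exI[of _ "p * [:0, 1:] ^ n + r * [:0, 1:] ^ m"] exI[of _ "m + n"])
      (simp add: ev_add distrib_right)
next
  case (walks p w p' c)
  show ?case
  proof (cases "V w \<in> J")
    case True
    then have "scal c * (pth p * (V w * gst p')) \<in> J"
      by (intro ideal_left[OF J(1)] ideal_right[OF J(1)])
    then show ?thesis
      by (intro exI[of _ 0]) (auto simp: cg_0_iff[OF J(1)] ideal_right[OF J(1)])
  next
    case False
    \<comment> \<open>Completing p' by r to a power of d makes p @ r closed at u, hence a power of d
      as well, while the ghost of p' cancels.\<close>
    from exitless_prefix[OF d walks(2) False] obtain m r
      where m: "p' @ r = concat (replicate m d)" by blast
    have "awalk u (p' @ r) u" using awalk_power[OF d(1)] m by simp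
    then obtain w' where "awalk u p' w'" "awalk w' r u" unfolding awalk_append by blast
    with walks(2) have r: "awalk w r u" using awalk_ends[of u p' w u w'] by auto
    from closed_walk_power[OF awalk_appendI[OF walks(1) r]] obtain j
      where j: "p @ r = concat (replicate j d)" by blast
    have "cg R (V w * gst p' * pth p' * (pth r * V u)) (V w * gst p' * pth p' * (V w * (pth r * V u)))"
      by (rule R_left[OF R_sym[OF V_pth[OF r]]])
    also have "\<dots> = V w * (gst p' * (pth p' * V w)) * (pth r * V u)" by (simp add: mult.assoc)
    also have "cg R \<dots> (V w * V w * (pth r * V u))"
      by (intro R_right R_left gst_pth[OF walks(2)])
    also have "cg R \<dots> (V w * (pth r * V u))" by (intro R_right V_V)
    also have "cg R \<dots> (pth r * V u)" by (rule V_pth[OF r])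
    finally have "cg R (scal c * pth p * (V w * gst p' * pth p' * (pth r * V u)))
        (scal c * pth p * (pth r * V u))" by (rule R_left)
    moreover have "pth p' * pth r = D ^ m" "pth p * pth r = D ^ j"
      using arg_cong[OF m, of pth] arg_cong[OF j, of pth] by (simp_all add: pth_power)
    ultimately have "cg R (scal c * (pth p * (V w * gst p')) * D ^ m * V u) (scal c * D ^ j * V u)"
      by (metis (no_types, lifting) mult.assoc)
    then show ?thesis
      by (intro exI[of _ "smult c ([:0, 1:] ^ j)"] exI[of _ m])
        (simp add: ev_smult ev_X_power cg_mono[OF _ J(2)])
  qed
qed

lemma corner_ev: "\<exists>p m. cg J (V u * x * V u * D ^ m * V u) (ev p * V u)"
  using corner_walk_span[of u x u] corner_walk_ev by blast

text \<open>By \<open>exitless_unit\<close> the power of \<open>D\<close> has its ghost as right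
  inverse at u modulo \<open>J\<close>.\<close>

lemma cancel_power:
  assumes T: "ring_ideal T" "J \<subseteq> T" and "x * D ^ m * V u \<in> T"
  shows "x * V u \<in> T"
proof -
  have "cg J (pth (concat (replicate m d)) * (V u * gst (concat (replicate m d)))) (V u)"
    using d(3) by (intro exitless_unit awalk_power d(1)) (auto simp: exitless_def set_concat split: if_splits)
  then have "cg J (x * (D ^ m * (V u * gst (concat (replicate m d))))) (x * V u)"
    unfolding pth_power by (rule cg_left[OF J(1)])
  moreover have "x * (D ^ m * (V u * gst (concat (replicate m d)))) \<in> T"
    using ideal_right[OF T(1) assms(3), of "gst (concat (replicate m d))"] by (simp add: mult.assoc)
  ultimately show ?thesis using cg_mem_iff[OF T(1) cg_mono[OF _ T(2)]] by blast
qed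

text \<open>The corner at \<open>u\<close> is commutative modulo \<open>J\<close>, so \<open>z\<close> can be moved out of the way.\<close>

lemma ev_sandwich:
  assumes T: "ring_ideal T" "J \<subseteq> T" and pr: "ev (p * r) * V u \<in> T"
  shows "ev p * V u * z * (ev r * V u) \<in> T"
proof -
  note T_iff = cg_mem_iff[OF T(1) cg_mono[OF _ T(2)]]
  obtain s m where s: "cg J (V u * z * V u * D ^ m * V u) (ev s * V u)" using corner_ev by blast
  note RJ = cg_mono[OF _ J(2)]
  have comm: "ev r * D ^ m = D ^ m * ev r"
    unfolding ev_X_power[symmetric] ev_mult[symmetric] by (simp add: mult.commute)
  \<comment> \<open>Cancellation needs \<open>D ^ m\<close> at the far right, but it clears the
    denominator of z only directly behind z; it commutes past \<open>ev r\<close>.\<close>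
  have 1: "cg R (ev r * V u * D ^ m * V u) (V u * D ^ m * V u * ev r * V u)"
  proof -
    have "cg R (ev r * (V u * D ^ m * V u)) (ev r * (D ^ m * V u))"
      using V_ev_V[of "[:0,1:] ^ m"] by (intro R_left) (simp add: ev_X_power)
    also have "ev r * (D ^ m * V u) = D ^ m * (ev r * V u)" using comm by (simp add: mult.assoc[symmetric])
    also have "cg R \<dots> (D ^ m * (V u * ev r * V u))" by (intro R_left R_sym[OF V_ev_V])
    also have "D ^ m * (V u * ev r * V u) = D ^ m * V u * (ev r * V u)" by (simp add: mult.assoc)
    also have "cg R \<dots> (V u * D ^ m * V u * (ev r * V u))"
      by (rule R_right[OF R_sym[OF V_ev_V[of "[:0, 1:] ^ m", unfolded ev_X_power]]])
    finally show ?thesis by (simp add: mult.assoc)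
  qed
  have "ev s * (ev (p * r) * V u) \<in> T" by (rule ideal_left[OF T(1) pr])
  \<comment> \<open>Once z is replaced by \<open>ev s\<close>, the factors commute and
    \<open>ev (p * r)\<close> can be collected.\<close>
  moreover have "cg J (ev p * (V u * z * V u * D ^ m * V u) * (ev r * V u)) (ev s * (ev (p * r) * V u))"
  proof -
    have "cg J (ev p * (V u * z * V u * D ^ m * V u) * (ev r * V u)) (ev p * (ev s * V u) * (ev r * V u))"
      by (intro cg_right[OF J(1)] cg_left[OF J(1)] s)
    also have "ev p * (ev s * V u) * (ev r * V u) = ev p * ev s * (V u * ev r * V u)"
      by (simp add: mult.assoc)
    also have "cg J \<dots> (ev p * ev s * (ev r * V u))" by (intro cg_left[OF J(1)] RJ V_ev_V)
    also have "ev p * ev s * (ev r * V u) = ev (p * s * r) * V u" by (simp add: ev_mult mult.assoc)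
    also have "p * s * r = s * (p * r)" by (simp add: ac_simps)
    also have "ev (s * (p * r)) * V u = ev s * (ev (p * r) * V u)"
      unfolding ev_mult[of s] by (simp add: mult.assoc)
    finally show ?thesis .
  qed
  ultimately have 2: "ev p * (V u * z * V u * D ^ m * V u) * (ev r * V u) \<in> T" using T_iff by blast
  have "cg R (ev p * V u * z * (ev r * V u * D ^ m * V u))
      (ev p * V u * z * (V u * D ^ m * V u * ev r * V u))"
    by (rule R_left[OF 1])
  then have "ev p * V u * z * (ev r * V u * D ^ m * V u) \<in> T"
    using T_iff[OF RJ] 2 by (simp add: mult.assoc)
  then have "ev p * V u * z * (ev r * V u) * D ^ m * V u \<in> T" by (simp add: mult.assoc)
  then have "ev p * V u * z * (ev r * V u) * V u \<in> T" by (rule cancel_power[OF T])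
  moreover have "cg R (ev p * V u * z * ev r * (V u * V u)) (ev p * V u * z * ev r * V u)"
    by (intro R_left V_V)
  ultimately show ?thesis using T_iff[OF RJ] by (simp add: mult.assoc)
qed

text \<open>The polynomials whose value at \<open>D\<close> lies in \<open>T\<close> at u form an
  ideal of the polynomial ring.\<close>

lemma corner_generator:
  assumes "ring_ideal T" "J \<subseteq> T"
  shows "\<exists>g. \<forall>p. ev p * V u \<in> T \<longleftrightarrow> g dvd p"
  using poly_ideal_principal[of "{p. ev p * V u \<in> T}"] assms
  by (auto simp: ev_add ev_mult distrib_right mult.assoc ideal_zero ideal_add ideal_left)

text \<open>In \<open>ideal_transfer\<close> only corners at vertices v on exitless closed walks
  remain. By \<open>conn\<close> those with v outside \<open>J\<close> can be carried to the corner
  at u, where membership is a matter of polynomials.\<close>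

lemma corner_determines:
  assumes W: "ring_ideal W" "J \<subseteq> W" "local_units W" and T: "ring_ideal T" "J \<subseteq> T"
    and gaps: "\<And>w F. finite F \<Longrightarrow> F \<subseteq> out_arcs E w \<Longrightarrow> gap w F \<in> W \<Longrightarrow> gap w F \<in> J"
    and conn: "\<And>v. V v \<notin> J \<Longrightarrow> \<exists>p w p'. awalk u p w \<and> awalk v p' w \<and> V w \<notin> J"
    and corner: "\<And>p. ev p * V u \<in> W \<Longrightarrow> ev p * V u \<in> T"
  shows "W \<subseteq> T"
proof (rule ideal_transfer[OF W(1) _ W(3) T(1)])
  note T_iff = cg_mem_iff[OF T(1) cg_mono[OF _ T(2)]]
  note W_iff = cg_mem_iff[OF W(1) cg_mono[OF _ W(2)]]
  note RJ = cg_mono[OF _ J(2)]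
  show "R \<subseteq> W" "R \<subseteq> T" using J W T by auto
  show "gap w F \<in> T" if "finite F" "F \<subseteq> out_arcs E w" "gap w F \<in> W" for w F
    using gaps[OF that] T by blast
  fix v c x assume c: "awalk v c v" "c \<noteq> []" "exitless W c" and x: "x \<in> W"
  have c': "exitless J c"
    using c gaps[of "{e}" "tail E e" for e] unfolding exitless_def awalk_def by auto
  show "V v * x * V v \<in> T"
  proof (cases "V v \<in> J")
    case True
    then show ?thesis using T by (intro ideal_left[OF T(1)]) auto
  next
    case False
    from conn[OF False] obtain p w p' where p: "awalk u p w" "awalk v p' w" "V w \<notin> J" by blast
    from exitless_prefix[OF c(1,2) c' p(2,3)] obtain m r
      where "p' @ r = concat (replicate m c)" by blast
    then have "set p' \<subseteq> set c"
      by (metis append_eq_conv_conj in_set_takeD set_concat set_replicate_conv_if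
          UN_E empty_iff singletonD subsetI)
    with c' have p'_ex: "exitless J p'" by (auto simp: exitless_def)
    \<comment> \<open>Both walks end at w. Since p' has no exits, \<open>s' * s\<close> is v modulo
      \<open>J\<close>, so conjugation carries the corner at v into the one at u and back.\<close>
    define s s' where "s = pth p * (V w * gst p')" and "s' = pth p' * (V w * gst p)"
    have s's: "cg J (s' * s) (V v)"
    proof -
      have "s' * s = pth p' * V w * (gst p * (pth p * V w)) * gst p'"
        by (simp add: s_def s'_def mult.assoc)
      also have "cg R \<dots> (pth p' * V w * V w * gst p')"
        by (intro R_right R_left gst_pth[OF p(1)])
      also have "\<dots> = pth p' * (V w * V w) * gst p'" by (simp add: mult.assoc)
      also have "cg R \<dots> (pth p' * V w * gst p')" by (intro R_right R_left V_V)
      finally have "cg J (s' * s) (pth p' * (V w * gst p'))" using RJ by (simp add: mult.assoc)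
      also have "cg J \<dots> (V v)" by (rule exitless_unit[OF p(2) p'_ex])
      finally show ?thesis .
    qed
    define z where "z = s * (V v * x * V v) * s'"
    have zW: "z \<in> W" unfolding z_def by (intro ideal_left[OF W(1)] ideal_right[OF W(1)] x)
    have "cg R (V u * z * V u) z"
    proof -
      have 1: "cg R (V u * s) s"
        using R_right[OF V_pth[OF p(1)], of "gst p'"] by (simp add: s_def mult.assoc)
      have 2: "cg R (s' * V u) s'"
        using R_left[OF gst_V[OF p(1)], of "pth p'"] by (simp add: s'_def mult.assoc)
      have "cg R (V u * s * (V v * x * V v) * (s' * V u)) (s * (V v * x * V v) * s')"
        by (intro R_mult R_right 1 2)
      then show ?thesis by (simp add: z_def mult.assoc)
    qed
    then have z: "cg J (V u * z * V u) z" by (rule RJ)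
    \<comment> \<open>Clear the denominators of z, transfer the resulting polynomial to
      \<open>T\<close>, and cancel the power of \<open>D\<close> there.\<close>
    obtain r k where r: "cg J (V u * z * V u * D ^ k * V u) (ev r * V u)" using corner_ev by blast
    have "V u * z * V u * D ^ k * V u \<in> W"
      by (intro ideal_left[OF W(1)] ideal_right[OF W(1)] zW)
    then have "ev r * V u \<in> T" using corner W_iff[OF r] by blast
    then have "V u * z * V u * D ^ k * V u \<in> T" using T_iff[OF r] by blast
    then have "V u * z * V u * V u \<in> T" by (rule cancel_power[OF T])
    moreover have "cg J (V u * z * (V u * V u)) (V u * z * V u)" by (rule RJ[OF R_left[OF V_V]])
    ultimately have "z \<in> T" using T_iff[OF z] T_iff by (simp add: mult.assoc)
    then have "s' * z * s \<in> T" by (intro ideal_left[OF T(1)] ideal_right[OF T(1)])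
    moreover have "cg J (s' * z * s) (V v * x * V v)"
    proof -
      have "s' * z * s = s' * s * (V v * x * V v) * (s' * s)" by (simp add: z_def mult.assoc)
      also have "cg J \<dots> (V v * (V v * x * V v) * V v)"
        by (intro cg_mult[OF J(1)] s's cg_refl[OF J(1)])
      also have "V v * (V v * x * V v) * V v = V v * V v * x * (V v * V v)" by (simp add: mult.assoc)
      also have "cg J \<dots> (V v * x * V v)" by (intro RJ R_mult V_V R_refl)
      finally show ?thesis .
    qed
    ultimately show ?thesis using T_iff by blast
  qed
qed

end

end

section \<open>Ideals with prime radical\<close>

text \<open>\<open>prime\<close> is primeness in elementwise form, tested on elements
  \<open>V u * a\<close> because in the application these have no constant term. \<open>nil\<close>
  is what is used of \<open>P\<close> being the radical of \<open>I\<close>.\<close>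

theorem radical_power:
  assumes I: "ring_ideal I" "R \<subseteq> I" "I \<subseteq> P" and P: "ring_ideal P" "local_units P"
    and prime: "\<And>u v a b. (\<And>x. V u * a * x * (V v * b) \<in> P) \<Longrightarrow> V u * a \<in> P \<or> V v * b \<in> P"
    and nil: "\<And>x. x \<in> P \<Longrightarrow> \<exists>m. x ^ Suc m \<in> I"
  shows "\<exists>n\<ge>1. I = ideal_product_power R P n"
proof -
  define J where "J = generated_ideal (gap_gens P)"
  have RP: "R \<subseteq> P" using I by blast
  have gap_I: "gap w F \<in> I" if "finite F" "F \<subseteq> out_arcs E w" "gap w F \<in> P" for w F
    using nil[OF that(3)] cg_mem_iff[OF I(1) cg_mono[OF gap_power[OF that(1,2)] I(2)]] by auto
  have J: "ring_ideal J" "R \<subseteq> J" unfolding J_def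
    by (auto simp: ring_ideal_generated gap_gens_def intro: generated_ideal.base)
  have gap_J: "gap w F \<in> J" if "finite F" "F \<subseteq> out_arcs E w" "gap w F \<in> P" for w F
    unfolding J_def by (intro generated_ideal.base gap_gensI that)
  have JI: "J \<subseteq> I"
    unfolding J_def using gap_I I by (intro generated_ideal_least) (auto simp: gap_gens_def)
  then have JP: "J \<subseteq> P" using I by blast
  have V_J: "V v \<in> J \<longleftrightarrow> V v \<in> P" for v using gap_J[of "{}" v] JP by auto
  have ex_J: "exitless J p" if "exitless P p" "awalk u p v" for p u v
    using that gap_J[of "{e}" "tail E e" for e] unfolding exitless_def awalk_def by auto
  have units_I: "local_units I" using P(2) I(3) by (auto simp: local_units_def)
  show ?thesis
  proof (cases "\<forall>u p. awalk u p u \<longrightarrow> p \<noteq> [] \<longrightarrow> exitless P p \<longrightarrow> V u \<in> P")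
    case True
    \<comment> \<open>All corners to be checked vanish modulo \<open>J\<close>, so the gaps alone
      generate \<open>P\<close> and the exponent is 1.\<close>
    have "P \<subseteq> J"
    proof (rule ideal_transfer[OF P(1) RP P(2) J])
      fix u p x assume "awalk u p u" "p \<noteq> []" "exitless P p"
      with True have "V u \<in> J" using V_J by blast
      then show "V u * x * V u \<in> J" by (intro ideal_left[OF J(1)])
    qed (rule gap_J)
    then show ?thesis using JI I by (intro exI[of _ 1]) auto
  next
    case False
    then obtain u d0 where d0: "awalk u d0 u" "d0 \<noteq> []" "exitless P d0" and "V u \<notin> P" by blast
    then have u: "V u \<notin> J" using V_J by blast
    obtain d where d: "awalk u d u" "d \<noteq> []"
      and shortest: "\<forall>p. awalk u p u \<longrightarrow> p \<noteq> [] \<longrightarrow> length d \<le> length p"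
      using ex_has_least_nat[of "\<lambda>p. awalk u p u \<and> p \<noteq> []" d0 length] d0 by blast
    \<comment> \<open>As a prefix of a power of d0, the shortest closed walk inherits the lack of
      exits.\<close>
    obtain m r where "d @ r = concat (replicate m d0)"
      using exitless_prefix[OF J d0(1,2) ex_J[OF d0(3,1)] d(1) u] by blast
    then have "set d \<subseteq> set (concat (replicate m d0))" by (metis set_append Un_upper1)
    then have "exitless J d"
      using ex_J[OF d0(3,1)] by (auto simp: exitless_def set_concat split: if_splits)
    note ctx = J d this u shortest
    let ?ev = "\<lambda>p. ev d p * V u"
    \<comment> \<open>Primeness gives x with \<open>V u * x * V v\<close> outside \<open>P\<close>,
      and a monomial of this corner element supplies the walks.\<close>
    have conn: "\<exists>p w p'. awalk u p w \<and> awalk v p' w \<and> V w \<notin> J" if v: "V v \<notin> J" for v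
    proof -
      have "\<exists>x. V u * x * V v \<notin> P"
        using prime[of u 1 v 1] v u V_J by auto
      then show ?thesis
        using corner_walk_span walk_span_mem[OF P(1) RP] V_J by metis
    qed
    obtain f where f: "\<And>p. ?ev p \<in> P \<longleftrightarrow> f dvd p"
      using corner_generator[OF ctx P(1) JP] by blast
    obtain g where g: "\<And>p. ?ev p \<in> I \<longleftrightarrow> g dvd p"
      using corner_generator[OF ctx I(1) JI] by blast
    note RJ = cg_mono[OF _ J(2)] and RP' = cg_mono[OF _ RP] and RI = cg_mono[OF _ I(2)]
    have ev_mult_V: "cg R (?ev p * ?ev r) (?ev (p * r))" for p r
      using R_left[OF V_ev_V[OF ctx, of r], of "ev d p"]
      by (simp add: ev_mult[OF ctx] mult.assoc)
    have f_not_unit: "\<not> f dvd 1"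
      using f[of 1] \<open>V u \<notin> P\<close> by (simp add: ev_1[OF ctx])
    have fg: "f dvd g" using f[of g] g[of g] I(3) by auto
    have "\<exists>n\<ge>1. g dvd f ^ n \<and> f ^ n dvd g"
    proof (cases "f = 0")
      \<comment> \<open>As f divides g, also g = 0.\<close>
      case True
      then show ?thesis using fg by (intro exI[of _ 1]) auto
    next
      case f0: False
      \<comment> \<open>If f divides a b, then by \<open>ev_sandwich\<close> the values of a and b
        at \<open>D\<close> have product in \<open>P\<close> with anything placed between, so
        primeness of \<open>P\<close> applies.\<close>
      have "prime_elem f"
      proof (rule prime_elemI[OF f0 f_not_unit])
        fix a b assume "f dvd a * b"
        then have ab: "?ev (a * b) \<in> P" using f by blast
        have V: "cg R (V u * ?ev p) (?ev p)" for p
          using V_ev_V[OF ctx, of p] by (simp add: mult.assoc)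
        have "V u * ?ev a * x * (V u * ?ev b) \<in> P" for x
        proof -
          have "cg R (V u * ?ev a * x * (V u * ?ev b)) (?ev a * x * ?ev b)"
            by (intro R_mult R_right V)
          then show ?thesis
            using ev_sandwich[OF ctx P(1) JP ab, of x] cg_mem_iff[OF P(1) RP'] by blast
        qed
        from prime[OF this] show "f dvd a \<or> f dvd b"
          using cg_mem_iff[OF P(1) RP'[OF V]] f by blast
      qed
      \<comment> \<open>The value of f at \<open>D\<close> lies in \<open>P\<close>, so one of its
        powers lies in \<open>I\<close>.\<close>
      moreover have "\<exists>k. g dvd f ^ k"
      proof -
        have "?ev f \<in> P" using f by simp
        then obtain k where k: "?ev f ^ Suc k \<in> I" using nil by blast
        have "cg R (?ev f ^ Suc k) (?ev (f ^ Suc k))"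
        proof (induction k)
          case (Suc k)
          have "cg R (?ev f * ?ev f ^ Suc k) (?ev f * ?ev (f ^ Suc k))" by (rule R_left[OF Suc.IH])
          also have "cg R \<dots> (?ev (f * f ^ Suc k))" by (rule ev_mult_V)
          finally show ?case by simp
        qed (simp add: R_refl)
        then have "?ev (f ^ Suc k) \<in> I" using k cg_mem_iff[OF I(1) RI] by blast
        then show ?thesis using g by blast
      qed
      ultimately obtain n where n: "g dvd f ^ n" "f ^ n dvd g"
        using dvd_prime_power_assoc by blast
      \<comment> \<open>For n = 0, f would divide g and g would divide 1.\<close>
      have "n \<noteq> 0" using n fg f_not_unit by (metis dvd_trans power_0)
      with n show ?thesis by (intro exI[of _ n]) auto
    qed
    then obtain n where n: "n \<ge> 1" "g dvd f ^ n" "f ^ n dvd g" by blast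
    \<comment> \<open>The candidate for the k-th power of \<open>P\<close>: generated by the gaps of
      \<open>P\<close> and one corner element. The plan is \<open>I = T n\<close>,
      \<open>P = T 1\<close>, and multiplying by \<open>P\<close> raises k by one.\<close>
    define T where "T k = generated_ideal (insert (?ev (f ^ k)) (gap_gens P))" for k
    have T: "ring_ideal (T k)" "J \<subseteq> T k" "?ev (f ^ k) \<in> T k" for k
    proof -
      show "ring_ideal (T k)" unfolding T_def by (rule ring_ideal_generated)
      show "?ev (f ^ k) \<in> T k" unfolding T_def by (rule generated_ideal.base) simp
      show "J \<subseteq> T k" unfolding J_def T_def
        by (intro generated_ideal_least ring_ideal_generated) (auto intro: generated_ideal.base)
    qed
    have T_least: "T k \<subseteq> W" if "ring_ideal W" "J \<subseteq> W" "?ev (f ^ k) \<in> W" for k W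
      unfolding T_def using that
      by (intro generated_ideal_least) (auto simp: J_def intro: generated_ideal.base)
    have T_dvd: "?ev p \<in> T k" if "f ^ k dvd p" for p k
    proof -
      from that obtain r where "p = r * f ^ k" by (metis dvdE mult.commute)
      then show ?thesis using ideal_left[OF T(1,3), of "ev d r"]
        by (simp add: ev_mult[OF ctx] mult.assoc)
    qed
    have "I \<subseteq> T n"
    proof (rule corner_determines[OF ctx I(1) JI units_I T(1,2)])
      show "gap w F \<in> J" if "finite F" "F \<subseteq> out_arcs E w" "gap w F \<in> I" for w F
        using gap_J that I by blast
      show "?ev p \<in> T n" if "?ev p \<in> I" for p
        using that n g by (intro T_dvd) (auto intro: dvd_trans)
    qed (rule conn)
    moreover have "T n \<subseteq> I" using T_least[OF I(1) JI] n g by blast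
    ultimately have I_T: "I = T n" by blast
    have "P \<subseteq> T 1"
    proof (rule corner_determines[OF ctx P(1) JP P(2) T(1,2)])
      show "?ev p \<in> T 1" if "?ev p \<in> P" for p
        using that f by (intro T_dvd) auto
    qed (use gap_J conn in auto)
    moreover have "T 1 \<subseteq> P" using T_least[OF P(1) JP] f by auto
    ultimately have P_T: "P = T 1" by blast
    have "ideal_product_power R P (Suc k) = T (Suc k)" for k
    proof (induction k)
      case 0
      then show ?case using P_T by simp
    next
      case (Suc k)
      let ?Q = "ideal_product R (T (Suc k)) P"
      have Q: "ring_ideal ?Q" by (rule ring_ideal_product[OF ideal_R T(1) P(1)])
      have RQ: "R \<subseteq> ?Q" by (auto intro: ideal_product.base)
      have "T (Suc (Suc k)) \<subseteq> ?Q"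
      proof (rule T_least[OF Q])
        show "J \<subseteq> ?Q"
          unfolding J_def
        proof (rule generated_ideal_least[OF Q])
          \<comment> \<open>A gap of \<open>P\<close> lies in both factors and is idempotent, so it
            survives in every power.\<close>
          have "gap w F \<in> ?Q" if "finite F" "F \<subseteq> out_arcs E w" "gap w F \<in> P" for w F
          proof -
            have "gap w F * gap w F \<in> ?Q"
              using gap_J[OF that] T(2) that(3) by (intro ideal_product.prod) auto
            then show ?thesis using cg_mem_iff[OF Q cg_mono[OF gap_idem[OF that(1,2)] RQ]] by blast
          qed
          then show "gap_gens P \<subseteq> ?Q" using RQ by (auto simp: gap_gens_def)
        qed
        have "?ev (f ^ Suc k) * ?ev f \<in> ?Q"
          by (rule ideal_product.prod[OF T(3)]) (simp add: f)
        moreover have "cg R (?ev (f ^ Suc k) * ?ev f) (?ev (f ^ Suc (Suc k)))"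
          using ev_mult_V[of "f ^ Suc k" f] by (simp add: ac_simps)
        ultimately show "?ev (f ^ Suc (Suc k)) \<in> ?Q" using cg_mem_iff[OF Q cg_mono[OF _ RQ]] by blast
      qed
      moreover have "?Q \<subseteq> T (Suc (Suc k))"
      proof
        fix x assume "x \<in> ?Q"
        then show "x \<in> T (Suc (Suc k))"
        proof (induction rule: ideal_product.induct)
          case (base x)
          then show ?case using J(2) T(2) by blast
        next
          case (prod a b)
          note T' = T[of "Suc (Suc k)"]
          have gens: "gap_gens P \<subseteq> T (Suc (Suc k))"
            using T'(2) by (auto simp: J_def intro: generated_ideal.base)
          let ?G = "\<lambda>k. insert (?ev (f ^ k)) (gap_gens P)"
          \<comment> \<open>Only the two corner generators meeting each other are not covered by a
            factor from \<open>gap_gens P\<close>; that case is \<open>ev_sandwich\<close>.\<close>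
          have *: "a * z * b \<in> T (Suc (Suc k))" if a: "a \<in> ?G (Suc k)" and b: "b \<in> ?G 1" for a b z
          proof -
            consider "a \<in> T (Suc (Suc k))" | "b \<in> T (Suc (Suc k))"
              | "a = ?ev (f ^ Suc k)" "b = ?ev f"
              using a b gens by auto
            then show ?thesis
            proof cases
              case 3
              have "?ev (f ^ Suc k * f) \<in> T (Suc (Suc k))" using T'(3) by (simp add: ac_simps)
              from ev_sandwich[OF ctx T'(1,2) this] show ?thesis unfolding 3 .
            qed (auto intro: ideal_left[OF T'(1)] ideal_right[OF T'(1)])
          qed
          have ab: "a \<in> generated_ideal (?G (Suc k))" "b \<in> generated_ideal (?G 1)"
            using prod P_T unfolding T_def by auto
          show ?case
            by (rule generated_ideal_mult[OF T'(1) _ ab]) (rule *)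
        next
          case (add x y)
          then show ?case using ideal_add[OF T(1)] by blast
        qed
      qed
      ultimately show ?case using Suc by simp
    qed
    then have "ideal_product_power R P n = T n" using n(1) by (metis Suc_pred' less_eq_Suc_le One_nat_def)
    then show ?thesis using I_T n(1) by blast
  qed
qed

end

section \<open>Passing to the quotient ring\<close>

text \<open>In the application \<open>A\<close> consists of the elements without constant term. The
  map \<open>\<phi>\<close> is total on the unital algebra, but its values belong to
  \<open>L\<close> only for arguments in \<open>A\<close>.\<close>

locale leavitt_quotient = leavitt_family E R scal V Ed Gh
  for E :: "('v, 'e) pre_digraph" and R :: "'a::ring_1 set" and scal :: "'k::field \<Rightarrow> 'a"
    and V :: "'v \<Rightarrow> 'a" and Ed Gh :: "'e \<Rightarrow> 'a" +
  fixes A :: "'a set" and L :: "'b ring" and \<phi> :: "'a \<Rightarrow> 'b"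
  assumes ideal_A: "ring_ideal A" and V_A: "V v \<in> A" and R_A: "R \<subseteq> A"
    and units_A: "local_units A"
    and \<phi>_eq: "\<phi> p = \<phi> r \<longleftrightarrow> cg R p r"
    and carrier_L: "carrier L = \<phi> ` A"
    and \<phi>_add: "\<phi> p \<oplus>\<^bsub>L\<^esub> \<phi> r = \<phi> (p + r)"
    and \<phi>_mult: "p \<in> A \<Longrightarrow> r \<in> A \<Longrightarrow> \<phi> p \<otimes>\<^bsub>L\<^esub> \<phi> r = \<phi> (p * r)"
    and \<phi>_zero: "\<zero>\<^bsub>L\<^esub> = \<phi> 0"
begin

definition preimage :: "'b set \<Rightarrow> 'a set" where
  "preimage I = {p \<in> A. \<phi> p \<in> I}"

text \<open>Ideals of \<open>L\<close> absorb factors from \<open>A\<close>, whereas the preimage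
  must absorb every a. Local units bridge this: x is congruent to u x u for some u in
  \<open>A\<close>, so a x is congruent to (a u) x u with a u in \<open>A\<close>.\<close>

lemma ideal_preimage:
  assumes I: "two_sided_ideal I L"
  shows "ring_ideal (preimage I)" "R \<subseteq> preimage I" "preimage I \<subseteq> A" "\<phi> ` preimage I = I"
proof -
  have sub: "I \<subseteq> carrier L" and zero: "\<phi> 0 \<in> I"
    and add: "\<And>x y. x \<in> I \<Longrightarrow> y \<in> I \<Longrightarrow> x \<oplus>\<^bsub>L\<^esub> y \<in> I"
    and left: "\<And>x a. x \<in> I \<Longrightarrow> a \<in> carrier L \<Longrightarrow> a \<otimes>\<^bsub>L\<^esub> x \<in> I"
    and right: "\<And>x a. x \<in> I \<Longrightarrow> a \<in> carrier L \<Longrightarrow> x \<otimes>\<^bsub>L\<^esub> a \<in> I"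
  proof -
    have S: "subgroup I (add_monoid L)"
      using I by (simp add: two_sided_ideal_def additive_subgroup_def)
    show "I \<subseteq> carrier L" "\<phi> 0 \<in> I"
      using subgroup.subset[OF S] subgroup.one_closed[OF S] by (simp_all add: \<phi>_zero)
    show "x \<oplus>\<^bsub>L\<^esub> y \<in> I" if "x \<in> I" "y \<in> I" for x y
      using subgroup.m_closed[OF S that] by simp
  qed (use I in \<open>auto simp: two_sided_ideal_def\<close>)
  show "preimage I \<subseteq> A" by (auto simp: preimage_def)
  show "\<phi> ` preimage I = I" using sub by (auto simp: preimage_def carrier_L)
  have \<phi>_R: "\<phi> r = \<phi> 0" if "r \<in> R" for r using that by (simp add: \<phi>_eq R_0_iff)
  show "R \<subseteq> preimage I" using R_A zero \<phi>_R by (auto simp: preimage_def)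
  show "ring_ideal (preimage I)"
  proof (rule ring_idealI)
    show "0 \<in> preimage I" using zero ideal_zero[OF ideal_A] by (simp add: preimage_def)
    show "x + y \<in> preimage I" if "x \<in> preimage I" "y \<in> preimage I" for x y
      using that add[of "\<phi> x" "\<phi> y"] ideal_add[OF ideal_A] by (auto simp: preimage_def \<phi>_add)
    fix x a assume "x \<in> preimage I"
    then have x: "x \<in> A" "\<phi> x \<in> I" by (auto simp: preimage_def)
    obtain S where S: "finite S" "cg R x ((\<Sum>v\<in>S. V v) * x * (\<Sum>v\<in>S. V v))"
      using units_A x(1) by (auto simp: local_units_def)
    let ?u = "\<Sum>v\<in>S. V v"
    have u: "?u \<in> A" by (intro ideal_sum[OF ideal_A] V_A)
    have au: "a * ?u \<in> A" "?u * a \<in> A" using u ideal_A by (auto intro: ideal_left ideal_right)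
    have xu: "x * ?u \<in> A" "?u * x \<in> A" using x ideal_A by (auto intro: ideal_left ideal_right)
    have "\<phi> (a * ?u) \<otimes>\<^bsub>L\<^esub> (\<phi> x \<otimes>\<^bsub>L\<^esub> \<phi> ?u) \<in> I"
      using left right x u au by (auto simp: carrier_L)
    then have "\<phi> (a * (?u * x * ?u)) \<in> I"
      using \<phi>_mult x u au xu by (simp add: mult.assoc)
    moreover have "\<phi> (a * x) = \<phi> (a * (?u * x * ?u))"
      unfolding \<phi>_eq by (rule R_left[OF S(2)])
    ultimately show "a * x \<in> preimage I"
      using x ideal_left[OF ideal_A] by (simp add: preimage_def)
    have "(\<phi> ?u \<otimes>\<^bsub>L\<^esub> \<phi> x) \<otimes>\<^bsub>L\<^esub> \<phi> (?u * a) \<in> I"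
      using left right x u au by (auto simp: carrier_L)
    then have "\<phi> (?u * x * ?u * a) \<in> I"
      using \<phi>_mult x u au xu by (simp add: mult.assoc)
    moreover have "\<phi> (x * a) = \<phi> (?u * x * ?u * a)"
      unfolding \<phi>_eq by (rule R_right[OF S(2)])
    ultimately show "x * a \<in> preimage I"
      using x ideal_right[OF ideal_A] by (simp add: preimage_def)
  qed
qed

lemma mem_image_iff:
  assumes "ring_ideal T" "R \<subseteq> T"
  shows "\<phi> x \<in> \<phi> ` T \<longleftrightarrow> x \<in> T"
proof
  assume "\<phi> x \<in> \<phi> ` T"
  then obtain y where "y \<in> T" "cg R x y" by (auto simp: \<phi>_eq)
  with assms show "x \<in> T" using cg_mem by blast
qed auto

lemma ideal_image:
  assumes T: "ring_ideal T" "T \<subseteq> A"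
  shows "two_sided_ideal (\<phi> ` T) L"
proof -
  \<comment> \<open>No group structure on \<open>L\<close> has been established, so the additive
    inverse is computed from its definition.\<close>
  have inv: "inv\<^bsub>add_monoid L\<^esub> (\<phi> x) = \<phi> (- x)" if "x \<in> A" for x
    unfolding m_inv_def
  proof (rule the_equality)
    show "\<phi> (- x) \<in> carrier (add_monoid L) \<and>
        \<phi> x \<otimes>\<^bsub>add_monoid L\<^esub> \<phi> (- x) = \<one>\<^bsub>add_monoid L\<^esub> \<and>
        \<phi> (- x) \<otimes>\<^bsub>add_monoid L\<^esub> \<phi> x = \<one>\<^bsub>add_monoid L\<^esub>"
      using that ideal_minus[OF ideal_A] by (simp add: \<phi>_add \<phi>_zero carrier_L)
    fix y assume "y \<in> carrier (add_monoid L) \<and>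
        \<phi> x \<otimes>\<^bsub>add_monoid L\<^esub> y = \<one>\<^bsub>add_monoid L\<^esub> \<and> y \<otimes>\<^bsub>add_monoid L\<^esub> \<phi> x = \<one>\<^bsub>add_monoid L\<^esub>"
    then obtain z where y: "y = \<phi> z" and "\<phi> x \<oplus>\<^bsub>L\<^esub> y = \<zero>\<^bsub>L\<^esub>" by (auto simp: carrier_L)
    then have "cg R (x + z) 0" by (simp add: \<phi>_add \<phi>_zero \<phi>_eq)
    then have "cg R z (- x)" by (simp add: cg_def add.commute)
    then show "y = \<phi> (- x)" using y by (simp add: \<phi>_eq)
  qed
  show ?thesis
    unfolding two_sided_ideal_def additive_subgroup_def
  proof (intro conjI ballI)
    show "subgroup (\<phi> ` T) (add_monoid L)"
    proof
      show "\<phi> ` T \<subseteq> carrier (add_monoid L)" using T by (auto simp: carrier_L)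
      show "x \<otimes>\<^bsub>add_monoid L\<^esub> y \<in> \<phi> ` T" if "x \<in> \<phi> ` T" "y \<in> \<phi> ` T" for x y
        using that ideal_add[OF T(1)] by (auto simp: \<phi>_add)
      show "\<one>\<^bsub>add_monoid L\<^esub> \<in> \<phi> ` T" using ideal_zero[OF T(1)] by (auto simp: \<phi>_zero)
      show "inv\<^bsub>add_monoid L\<^esub> x \<in> \<phi> ` T" if "x \<in> \<phi> ` T" for x
      proof -
        from that obtain y where "y \<in> T" "x = \<phi> y" by blast
        then show ?thesis using inv[of y] T ideal_minus[OF T(1)] by auto
      qed
    qed
    fix a x assume "a \<in> \<phi> ` T" "x \<in> carrier L"
    then obtain b y where "a = \<phi> b" "b \<in> T" "x = \<phi> y" "y \<in> A" by (auto simp: carrier_L)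
    then show "x \<otimes>\<^bsub>L\<^esub> a \<in> \<phi> ` T" "a \<otimes>\<^bsub>L\<^esub> x \<in> \<phi> ` T"
      using \<phi>_mult[of y b] \<phi>_mult[of b y] T ideal_left[OF T(1)] ideal_right[OF T(1)] by auto
  qed
qed

lemma ideal_prod_image:
  assumes S: "ring_ideal S" "S \<subseteq> A" and T: "ring_ideal T" "T \<subseteq> A"
  shows "ideal_prod L (\<phi> ` S) (\<phi> ` T) = \<phi> ` ideal_product R S T"
proof (intro equalityI subsetI)
  fix x assume "x \<in> ideal_prod L (\<phi> ` S) (\<phi> ` T)"
  then show "x \<in> \<phi> ` ideal_product R S T"
  proof (induction rule: ideal_prod.induct)
    case (prod i j)
    then obtain a b where "i = \<phi> a" "a \<in> S" "j = \<phi> b" "b \<in> T" by blast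
    then show ?case using \<phi>_mult[of a b] S T by (auto intro: ideal_product.prod)
  next
    case (sum x y)
    then show ?case by (auto simp: \<phi>_add intro: ideal_product.add)
  qed
next
  fix x assume "x \<in> \<phi> ` ideal_product R S T"
  then obtain p where p: "p \<in> ideal_product R S T" "x = \<phi> p" by blast
  have prod: "\<phi> (a * b) \<in> ideal_prod L (\<phi> ` S) (\<phi> ` T)" if "a \<in> S" "b \<in> T" for a b
  proof -
    have "\<phi> a \<otimes>\<^bsub>L\<^esub> \<phi> b = \<phi> (a * b)" using that S T by (intro \<phi>_mult) auto
    then show ?thesis
      using ideal_prod.prod[of "\<phi> a" "\<phi> ` S" "\<phi> b" "\<phi> ` T" L] that by simp
  qed
  from p(1) have "\<phi> p \<in> ideal_prod L (\<phi> ` S) (\<phi> ` T)"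
  proof (induction rule: ideal_product.induct)
    case (base p)
    \<comment> \<open>An element of \<open>R\<close> vanishes in \<open>L\<close>, where zero is
      itself a product of members.\<close>
    then have "\<phi> p = \<phi> (0 * 0)" by (simp add: \<phi>_eq R_0_iff)
    then show ?case using prod[of 0 0] ideal_zero[OF S(1)] ideal_zero[OF T(1)] by simp
  next
    case (add p r)
    then show ?case using ideal_prod.sum by (simp add: \<phi>_add[symmetric])
  qed (rule prod)
  then show "x \<in> ideal_prod L (\<phi> ` S) (\<phi> ` T)" using p by simp
qed

lemma ideal_product_least:
  assumes "ring_ideal T" "R \<subseteq> T" "\<And>a b. a \<in> S \<Longrightarrow> b \<in> S' \<Longrightarrow> a * b \<in> T"
  shows "ideal_product R S S' \<subseteq> T"
proof
  fix x assume "x \<in> ideal_product R S S'"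
  then show "x \<in> T"
    by (induction rule: ideal_product.induct) (use assms in \<open>auto intro: ideal_add\<close>)
qed

lemma ideal_power_image:
  assumes T: "ring_ideal T" "T \<subseteq> A"
  shows "ideal_power L (\<phi> ` T) (Suc n) = \<phi> ` ideal_product_power R T (Suc n)"
proof -
  have "ring_ideal (ideal_product_power R T (Suc n)) \<and> ideal_product_power R T (Suc n) \<subseteq> A \<and>
      ideal_power L (\<phi> ` T) (Suc n) = \<phi> ` ideal_product_power R T (Suc n)"
  proof (induction n)
    case (Suc n)
    let ?S = "ideal_product_power R T (Suc n)"
    from Suc have S: "ring_ideal ?S" "?S \<subseteq> A" by auto
    have "ideal_product R ?S T \<subseteq> A"
      using T by (intro ideal_product_least ideal_A R_A) (auto intro: ideal_left[OF ideal_A])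
    then show ?case
      using Suc ring_ideal_product[OF ideal_R S(1) T(1)] ideal_prod_image[OF S T] by simp
  qed (use T in simp)
  then show ?thesis by blast
qed

text \<open>By \<open>generated_ideal_mult\<close> the ideals generated by a and by b have their
  product in the preimage; primeness applies to their images.\<close>

lemma prime_preimage:
  assumes P: "prime_two_sided_ideal P L" and a: "a \<in> A" "b \<in> A"
    and ab: "\<And>x. a * x * b \<in> preimage P"
  shows "a \<in> preimage P \<or> b \<in> preimage P"
proof -
  have P': "two_sided_ideal P L" using P by (simp add: prime_two_sided_ideal_def)
  note PP = ideal_preimage[OF P']
  let ?G = "\<lambda>c. generated_ideal {c}"
  have G: "ring_ideal (?G c)" "?G c \<subseteq> A" if "c \<in> A" for c
    using that by (auto intro: ring_ideal_generated generated_ideal_least[OF ideal_A, THEN subsetD])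
  have "ideal_product R (?G a) (?G b) \<subseteq> preimage P"
    using ab by (intro ideal_product_least PP) (auto intro: generated_ideal_mult[OF PP(1), of "{a}" "{b}"])
  then have "ideal_prod L (\<phi> ` ?G a) (\<phi> ` ?G b) \<subseteq> P"
    using ideal_prod_image[OF G[OF a(1)] G[OF a(2)]] by (auto simp: preimage_def)
  then have "\<phi> ` ?G a \<subseteq> P \<or> \<phi> ` ?G b \<subseteq> P"
    using P ideal_image[OF G[OF a(1)]] ideal_image[OF G[OF a(2)]]
    by (simp add: prime_two_sided_ideal_def)
  then show ?thesis using a by (auto simp: preimage_def intro: generated_ideal.base)
qed

text \<open>Otherwise Zorn's lemma gives an ideal \<open>M\<close> maximal among those containing
  the preimage of \<open>I\<close> and avoiding all positive powers of x. Its image is prime and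
  contains \<open>I\<close> but not the image of x, against the choice of x. Positive exponents keep
  the powers inside \<open>A\<close>.\<close>

lemma radical_power_mem:
  assumes I: "two_sided_ideal I L" and x: "x \<in> preimage (ideal_radical L I)"
  shows "\<exists>m. x ^ Suc m \<in> preimage I"
proof (rule ccontr)
  assume no: "\<not> ?thesis"
  note II = ideal_preimage[OF I]
  define C where "C = {Q. ring_ideal Q \<and> preimage I \<subseteq> Q \<and> Q \<subseteq> A \<and> (\<forall>m. x ^ Suc m \<notin> Q)}"
  have "preimage I \<in> C" using II no by (auto simp: C_def)
  have "\<exists>M\<in>C. \<forall>X\<in>C. M \<subseteq> X \<longrightarrow> X = M"
  proof (rule subset_Zorn_nonempty)
    show "C \<noteq> {}" using \<open>preimage I \<in> C\<close> by blast
    fix \<C> assume ne: "\<C> \<noteq> {}" and chain: "subset.chain C \<C>"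
    then have mem: "\<And>Q. Q \<in> \<C> \<Longrightarrow> Q \<in> C"
      and lin: "\<And>Q Q'. Q \<in> \<C> \<Longrightarrow> Q' \<in> \<C> \<Longrightarrow> Q \<subseteq> Q' \<or> Q' \<subseteq> Q"
      by (auto simp: subset.chain_def)
    have "ring_ideal (\<Union>\<C>)"
    proof (rule ring_idealI)
      show "0 \<in> \<Union>\<C>" using ne mem ideal_zero by (fastforce simp: C_def)
      show "y + z \<in> \<Union>\<C>" if yz: "y \<in> \<Union>\<C>" "z \<in> \<Union>\<C>" for y z
      proof -
        from yz lin obtain Q where "Q \<in> \<C>" "y \<in> Q" "z \<in> Q" by blast
        then show ?thesis using mem[of Q] ideal_add[of Q y z] by (auto simp: C_def)
      qed
      show "a * y \<in> \<Union>\<C>" "y * a \<in> \<Union>\<C>" if y: "y \<in> \<Union>\<C>" for y a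
        using y mem ideal_left[of _ y a] ideal_right[of _ y a] by (fastforce simp: C_def)+
    qed
    moreover have "preimage I \<subseteq> \<Union>\<C>" using ne mem by (fastforce simp: C_def)
    moreover have "\<Union>\<C> \<subseteq> A" "\<forall>m. x ^ Suc m \<notin> \<Union>\<C>" using mem by (auto simp: C_def)
    ultimately show "\<Union>\<C> \<in> C" by (simp add: C_def)
  qed
  then obtain M where "M \<in> C" and max: "\<And>X. X \<in> C \<Longrightarrow> M \<subseteq> X \<Longrightarrow> X = M" by blast
  then have M: "ring_ideal M" "preimage I \<subseteq> M" "M \<subseteq> A" and xM: "\<And>m. x ^ Suc m \<notin> M"
    by (auto simp: C_def)
  have RM: "R \<subseteq> M" using M II by blast
  \<comment> \<open>By maximality \<open>M + preimage B\<close> contains a power of x.\<close>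
  have large: "\<exists>m y. y \<in> preimage B \<and> x ^ Suc m - y \<in> M"
    if B: "two_sided_ideal B L" "\<not> B \<subseteq> \<phi> ` M" for B
  proof -
    note BB = ideal_preimage[OF B(1)]
    let ?X = "{y + z |y z. y \<in> M \<and> z \<in> preimage B}"
    have "ring_ideal ?X"
    proof (rule ring_idealI)
      show "0 \<in> ?X" using ideal_zero[OF M(1)] ideal_zero[OF BB(1)] by force
      show "a + b \<in> ?X" if ab: "a \<in> ?X" "b \<in> ?X" for a b
      proof -
        from ab obtain y z y' z' where "a = y + z" "b = y' + z'" "y \<in> M" "y' \<in> M"
          "z \<in> preimage B" "z' \<in> preimage B" by blast
        then have "a + b = (y + y') + (z + z')" "y + y' \<in> M" "z + z' \<in> preimage B"
          using ideal_add[OF M(1)] ideal_add[OF BB(1)] by auto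
        then show ?thesis by blast
      qed
      show "c * a \<in> ?X" "a * c \<in> ?X" if a: "a \<in> ?X" for a c
      proof -
        from a obtain y z where "a = y + z" "y \<in> M" "z \<in> preimage B" by blast
        then have "c * a = c * y + c * z" "a * c = y * c + z * c" "c * y \<in> M" "y * c \<in> M"
          "c * z \<in> preimage B" "z * c \<in> preimage B"
          by (simp_all only: distrib_left distrib_right ideal_left[OF M(1)] ideal_left[OF BB(1)]
              ideal_right[OF M(1)] ideal_right[OF BB(1)])
        then show "c * a \<in> ?X" "a * c \<in> ?X" by blast+
      qed
    qed
    moreover have MX: "M \<subseteq> ?X" using ideal_zero[OF BB(1)] by force
    moreover have "?X \<subseteq> A" using M(3) BB(3) ideal_add[OF ideal_A] by blast
    moreover have "?X \<noteq> M"
    proof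
      assume "?X = M"
      moreover have "preimage B \<subseteq> ?X" using ideal_zero[OF M(1)] by force
      ultimately have "preimage B \<subseteq> M" by simp
      then have "\<phi> ` preimage B \<subseteq> \<phi> ` M" by (rule image_mono)
      then show False using B(2) BB(4) by simp
    qed
    ultimately have notC: "?X \<notin> C" using max by blast
    have "\<exists>m. x ^ Suc m \<in> ?X"
    proof (rule ccontr)
      assume "\<not> ?thesis"
      then have "\<forall>m. x ^ Suc m \<notin> ?X" by (rule not_ex[THEN iffD1])
      with \<open>ring_ideal ?X\<close> subset_trans[OF M(2) MX] \<open>?X \<subseteq> A\<close> have "?X \<in> C"
        unfolding C_def by (intro CollectI conjI)
      with notC show False by (rule notE)
    qed
    then obtain m where "x ^ Suc m \<in> ?X" by (rule exE)
    then obtain y z where "x ^ Suc m = y + z" "y \<in> M" "z \<in> preimage B" by blast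
    then show ?thesis by (intro exI[of _ m] exI[of _ z]) simp
  qed
  have "x \<in> A" using x by (simp add: preimage_def)
  have \<phi>x: "\<phi> x \<notin> \<phi> ` M" using xM[of 0] mem_image_iff[OF M(1) RM] by simp
  have "prime_two_sided_ideal (\<phi> ` M) L"
    unfolding prime_two_sided_ideal_def
  proof (intro conjI allI impI)
    show "two_sided_ideal (\<phi> ` M) L" by (rule ideal_image[OF M(1,3)])
    show "\<phi> ` M \<noteq> carrier L" using \<phi>x \<open>x \<in> A\<close> by (auto simp: carrier_L)
    fix B B' assume B: "two_sided_ideal B L" "two_sided_ideal B' L"
      and prod: "ideal_prod L B B' \<subseteq> \<phi> ` M"
    show "B \<subseteq> \<phi> ` M \<or> B' \<subseteq> \<phi> ` M"
    proof (rule ccontr)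
      assume no: "\<not> ?thesis"
      from no large[OF B(1)] obtain m y where y: "y \<in> preimage B" "cg M (x ^ Suc m) y"
        by (auto simp: cg_def)
      from no large[OF B(2)] obtain n z where z: "z \<in> preimage B'" "cg M (x ^ Suc n) z"
        by (auto simp: cg_def)
      have "\<phi> y \<otimes>\<^bsub>L\<^esub> \<phi> z \<in> \<phi> ` M"
        using y(1) z(1) prod by (auto simp: preimage_def intro: ideal_prod.prod)
      then have "\<phi> (y * z) \<in> \<phi> ` M"
        using \<phi>_mult[of y z] y(1) z(1) by (simp add: preimage_def)
      then have "y * z \<in> M" using mem_image_iff[OF M(1) RM] by blast
      \<comment> \<open>Two powers of x are congruent to y and z modulo \<open>M\<close>, so their
        product, again a power of x, would lie in \<open>M\<close>.\<close>
      moreover have "cg M (x ^ Suc m * x ^ Suc n) (y * z)"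
        by (rule cg_mult[OF M(1) y(2) z(2)])
      ultimately have "x ^ Suc (m + Suc n) \<in> M"
        using cg_mem_iff[OF M(1)] by (metis power_add add_Suc)
      then show False using xM by blast
    qed
  qed
  moreover have "I \<subseteq> \<phi> ` M" using M(2) II(4) by blast
  ultimately have "\<phi> x \<in> \<phi> ` M"
    using x by (auto simp: preimage_def ideal_radical_def)
  with \<phi>x show False by blast
qed

theorem radical_prime_power:
  assumes I: "two_sided_ideal I L" and P: "prime_two_sided_ideal (ideal_radical L I) L"
  shows "\<exists>n\<ge>1. I = ideal_power L (ideal_radical L I) n"
proof -
  let ?P = "ideal_radical L I"
  have P': "two_sided_ideal ?P L" using P by (simp add: prime_two_sided_ideal_def)
  note II = ideal_preimage[OF I] and PP = ideal_preimage[OF P']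
  have "I \<subseteq> carrier L" using II(3,4) unfolding carrier_L by blast
  then have "I \<subseteq> ?P" by (auto simp: ideal_radical_def)
  then have IP: "preimage I \<subseteq> preimage ?P" by (auto simp: preimage_def)
  have "local_units (preimage ?P)" using units_A PP(3) by (auto simp: local_units_def)
  moreover have "V u * a \<in> preimage ?P \<or> V v * b \<in> preimage ?P"
    if "\<And>x. V u * a * x * (V v * b) \<in> preimage ?P" for u v a b
    using that by (intro prime_preimage[OF P]) (auto intro: ideal_right[OF ideal_A] V_A)
  ultimately have "\<exists>n\<ge>1. preimage I = ideal_product_power R (preimage ?P) n"
    using radical_power[OF II(1,2) IP PP(1)] radical_power_mem[OF I] by blast
  then obtain n where "n \<ge> 1" "preimage I = ideal_product_power R (preimage ?P) n" by blast
  then have "\<phi> ` preimage I = ideal_power L (\<phi> ` preimage ?P) n"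
    using ideal_power_image[OF PP(1,3), of "n - 1"] by simp
  then show ?thesis using \<open>n \<ge> 1\<close> II(4) PP(4) by auto
qed

end

section \<open>The presentation by generators and relations\<close>

lemma poly_mapping_single_induct [case_names single add]:
  assumes single: "\<And>k v. Q (Poly_Mapping.single k v)" and add: "\<And>a b. Q a \<Longrightarrow> Q b \<Longrightarrow> Q (a + b)"
  shows "Q p"
proof (induction p rule: update_induct)
  case const
  then show ?case using single[of undefined 0] by simp
next
  case (update f a b)
  then have "Poly_Mapping.update a b f = Poly_Mapping.single a b + f"
    by (intro poly_mapping_eqI)
      (auto simp: lookup_update lookup_add lookup_single when_def in_keys_iff)
  then show ?case using add single update by simp
qed

lift_definition restrict_keys :: "'a set \<Rightarrow> ('a \<Rightarrow>\<^sub>0 'b::zero) \<Rightarrow> 'a \<Rightarrow>\<^sub>0 'b"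
  is "\<lambda>W f a. if a \<in> W then f a else 0"
  by (rule rev_finite_subset) auto

lemma restrict_keys_add: "restrict_keys W (p + r) = restrict_keys W p + restrict_keys W (r :: 'a \<Rightarrow>\<^sub>0 'b::monoid_add)"
  by (transfer) auto

lemma restrict_keys_diff: "restrict_keys W (p - r) = restrict_keys W p - restrict_keys W (r :: 'a \<Rightarrow>\<^sub>0 'b::ab_group_add)"
  by (transfer) auto

lemma restrict_keys_single:
  "restrict_keys W (Poly_Mapping.single k v) = (if k \<in> W then Poly_Mapping.single k v else 0)"
  by (rule poly_mapping_eqI) (auto simp: restrict_keys.rep_eq lookup_single when_def)

lemma restrict_keys_0 [simp]: "restrict_keys W 0 = 0"
  by transfer auto

lemma restrict_keys_idem: "restrict_keys W (restrict_keys W p) = restrict_keys W p"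
  by transfer auto

text \<open>\<open>W\<close> is closed under sums and under summands, so a product of two monomials
  survives exactly when both factors do.\<close>

lemma restrict_keys_mult:
  fixes p r :: "'a::monoid_add \<Rightarrow>\<^sub>0 'b::ring"
  assumes W: "\<And>u w. u + w \<in> W \<longleftrightarrow> u \<in> W \<and> w \<in> W"
  shows "restrict_keys W (p * r) = restrict_keys W p * restrict_keys W r"
proof (induction p rule: poly_mapping_single_induct)
  case (single k v)
  show ?case
    by (induction r rule: poly_mapping_single_induct)
      (auto simp: mult_single restrict_keys_single W restrict_keys_add distrib_left)
qed (simp add: restrict_keys_add distrib_right)

lemma single_0_central:
  "p * Poly_Mapping.single 0 c = Poly_Mapping.single 0 c * (p :: 'a::monoid_add \<Rightarrow>\<^sub>0 'k::comm_ring)"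
  by (induction p rule: poly_mapping_single_induct)
    (simp_all add: mult_single distrib_left distrib_right mult.commute)

lemma Word_add: "Word a + Word b = Word (a @ b)"
  by (simp add: plus_word_def)

lemma letters_add: "letters (u + w) = letters u @ letters w"
  by (simp add: plus_word_def)

lemma letters_0: "letters 0 = []"
  by (simp add: zero_word_def)

lemma word_eq_0_iff: "w = 0 \<longleftrightarrow> letters w = []"
  by (cases w) (simp add: zero_word_def)

text \<open>A concatenation is empty only when both words are.\<close>

lemma lookup_mult_0:
  fixes p r :: "'g word \<Rightarrow>\<^sub>0 'k::ring"
  shows "Poly_Mapping.lookup (p * r) 0 = Poly_Mapping.lookup p 0 * Poly_Mapping.lookup r 0"
proof (induction p rule: poly_mapping_single_induct)
  case (single k v)
  show ?case
    by (induction r rule: poly_mapping_single_induct)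
      (auto simp: mult_single lookup_single when_def lookup_add distrib_left word_eq_0_iff letters_add)
qed (simp add: lookup_add distrib_right)

lemma lookup_gen_0 [simp]: "Poly_Mapping.lookup (gen x) 0 = 0"
  by (simp add: gen_def lookup_single when_def zero_word_def)

section \<open>The quotient by relations over a subset of the symbols\<close>

context
  fixes X :: "'g set"
begin

text \<open>A retraction of the free algebra on all symbols onto the one on \<open>X\<close>,
  sending the other symbols to 0.\<close>

definition supported :: "('g word \<Rightarrow>\<^sub>0 'k::field) \<Rightarrow> 'g word \<Rightarrow>\<^sub>0 'k" where
  "supported = restrict_keys {w. set (letters w) \<subseteq> X}"

lemma supported_simps [simp]:
  "supported 0 = 0" "supported (p + r) = supported p + supported r"
  "supported (p - r) = supported p - supported r" "supported (p * r) = supported p * supported r"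
  "supported (supported p) = supported p"
  "supported (Poly_Mapping.single 0 c) = Poly_Mapping.single 0 c"
  "supported (gen x) = (if x \<in> X then gen x else 0)"
  "Poly_Mapping.lookup (supported p) 0 = Poly_Mapping.lookup p 0"
  by (auto simp: supported_def restrict_keys_add restrict_keys_diff restrict_keys_mult letters_add
      restrict_keys_idem restrict_keys_single letters_0 gen_def restrict_keys.rep_eq)

lemma supported_sum [simp]: "supported (sum f A) = (\<Sum>x\<in>A. supported (f x))"
  by (induction A rule: infinite_finite_induct) simp_all

lemma carrier_free_algebra:
  "p \<in> carrier (free_algebra X) \<longleftrightarrow> supported p = p \<and> Poly_Mapping.lookup p 0 = 0"
proof -
  have "supported p = p \<longleftrightarrow> (\<forall>w\<in>Poly_Mapping.keys p. set (letters w) \<subseteq> X)"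
    by (auto simp: supported_def poly_mapping_eq_iff fun_eq_iff restrict_keys.rep_eq in_keys_iff)
  moreover have "Poly_Mapping.lookup p 0 = 0 \<longleftrightarrow> (\<forall>w\<in>Poly_Mapping.keys p. letters w \<noteq> [])"
    by (auto simp: in_keys_iff word_eq_0_iff[symmetric])
  ultimately show ?thesis by (auto simp: free_algebra_def)
qed

context
  fixes S :: "('g word \<Rightarrow>\<^sub>0 'k::field) set"
  assumes S: "S \<subseteq> carrier (free_algebra X)"
begin

abbreviation (input) "N \<equiv> algebra_ideal_generated X S"

lemma relations_carrier: "p \<in> N \<Longrightarrow> p \<in> carrier (free_algebra X)"
  by (induction rule: algebra_ideal_generated.induct)
    (use S in \<open>auto simp: carrier_free_algebra lookup_add lookup_mult_0\<close>)

text \<open>Pulling back along \<open>supported\<close> adjoins the symbols outside \<open>X\<close>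
  to the relations. With the relations of a graph this is the \<open>R\<close> of the earlier
  locales.\<close>

definition free_relations :: "('g word \<Rightarrow>\<^sub>0 'k) set" where
  "free_relations = {p. supported p \<in> N}"

definition quotient_map :: "('g word \<Rightarrow>\<^sub>0 'k) \<Rightarrow> ('g word \<Rightarrow>\<^sub>0 'k) set" where
  "quotient_map p = N +>\<^bsub>free_algebra X\<^esub> supported p"

lemma relations_minus: "p \<in> N \<Longrightarrow> - p \<in> N"
  using algebra_ideal_generated.scale[of p X S "-1"]
  by (metis mult_minus1 single_one single_uminus)

text \<open>The rules of the generated ideal admit scalars and elements without constant term as
  factors. A general factor is a sum of monomials, the empty word being the scalar case.\<close>

lemma relations_left: "r \<in> N \<Longrightarrow> supported a * r \<in> N"
proof (induction a rule: poly_mapping_single_induct)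
  case (single k v)
  show ?case
  proof (cases "k = 0")
    case True
    then show ?thesis using single by (simp add: algebra_ideal_generated.scale)
  next
    case False
    then have "supported (Poly_Mapping.single k v) \<in> carrier (free_algebra X)"
      by (simp add: carrier_free_algebra lookup_single when_def)
    then show ?thesis using single by (rule algebra_ideal_generated.left)
  qed
qed (simp add: distrib_right algebra_ideal_generated.add)

lemma relations_right: "r \<in> N \<Longrightarrow> r * supported a \<in> N"
proof (induction a rule: poly_mapping_single_induct)
  case (single k v)
  show ?case
  proof (cases "k = 0")
    case True
    then show ?thesis using single by (simp add: single_0_central algebra_ideal_generated.scale)
  next
    case False
    then have "supported (Poly_Mapping.single k v) \<in> carrier (free_algebra X)"
      by (simp add: carrier_free_algebra lookup_single when_def)
    then show ?thesis using single by (rule algebra_ideal_generated.right)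
  qed
qed (simp add: distrib_left algebra_ideal_generated.add)

lemma ideal_free_relations: "ring_ideal free_relations"
  by (rule ring_idealI)
    (auto simp: free_relations_def relations_left relations_right
      intro: algebra_ideal_generated.zero algebra_ideal_generated.add)

lemma quotient_map_altdef: "quotient_map p = {x. x - supported p \<in> N}"
proof -
  have "quotient_map p = (\<lambda>h. h + supported p) ` N"
    by (auto simp: quotient_map_def a_r_coset_def r_coset_def free_algebra_def)
  then show ?thesis by (force simp: image_iff algebra_simps)
qed

lemma quotient_map_eq: "quotient_map p = quotient_map r \<longleftrightarrow> cg free_relations p r"
proof
  assume "quotient_map p = quotient_map r"
  moreover have "supported p \<in> quotient_map p"
    by (simp add: quotient_map_altdef algebra_ideal_generated.zero)
  ultimately show "cg free_relations p r"
    by (simp add: cg_def free_relations_def quotient_map_altdef)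
next
  assume "cg free_relations p r"
  then have N: "supported p - supported r \<in> N" by (simp add: cg_def free_relations_def)
  have "x - supported p \<in> N \<longleftrightarrow> x - supported r \<in> N" for x
    using algebra_ideal_generated.add[OF _ N, of "x - supported p"]
      algebra_ideal_generated.add[OF _ relations_minus[OF N], of "x - supported r"] by auto
  then show "quotient_map p = quotient_map r" by (simp add: quotient_map_altdef)
qed

lemma carrier_quotient:
  "carrier (free_algebra X Quot N) = quotient_map ` {p. Poly_Mapping.lookup p 0 = 0}"
proof -
  have "carrier (free_algebra X Quot N) = (\<lambda>p. N +>\<^bsub>free_algebra X\<^esub> p) ` carrier (free_algebra X)"
    by (auto simp: FactRing_def A_RCOSETS_def RCOSETS_def a_r_coset_def)
  also have "carrier (free_algebra X) = supported ` {p. Poly_Mapping.lookup p 0 = 0}"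
    by (force simp: carrier_free_algebra image_iff)
  finally show ?thesis by (simp add: image_image quotient_map_def)
qed

lemma quotient_map_zero: "\<zero>\<^bsub>free_algebra X Quot N\<^esub> = quotient_map 0"
  by (simp add: FactRing_def quotient_map_altdef)

lemma quotient_map_add:
  "quotient_map p \<oplus>\<^bsub>free_algebra X Quot N\<^esub> quotient_map r = quotient_map (p + r)"
proof -
  have "quotient_map p \<oplus>\<^bsub>free_algebra X Quot N\<^esub> quotient_map r =
      {x + y |x y. x \<in> quotient_map p \<and> y \<in> quotient_map r}"
    by (auto simp: FactRing_def set_add_def set_mult_def free_algebra_def)
  also have "\<dots> = quotient_map (p + r)"
  proof (intro equalityI subsetI)
    fix z assume "z \<in> {x + y |x y. x \<in> quotient_map p \<and> y \<in> quotient_map r}"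
    then obtain x y where "z = x + y" "x - supported p \<in> N" "y - supported r \<in> N"
      by (auto simp: quotient_map_altdef)
    then show "z \<in> quotient_map (p + r)"
      using algebra_ideal_generated.add[of "x - supported p" X S "y - supported r"]
      by (simp add: quotient_map_altdef algebra_simps)
  next
    fix z assume "z \<in> quotient_map (p + r)"
    then have "z - supported r \<in> quotient_map p" "supported r \<in> quotient_map r"
      by (auto simp: quotient_map_altdef algebra_ideal_generated.zero algebra_simps)
    then show "z \<in> {x + y |x y. x \<in> quotient_map p \<and> y \<in> quotient_map r}" by force
  qed
  finally show ?thesis .
qed

lemma quotient_map_mult:
  assumes "Poly_Mapping.lookup p 0 = 0" "Poly_Mapping.lookup r 0 = 0"
  shows "quotient_map p \<otimes>\<^bsub>free_algebra X Quot N\<^esub> quotient_map r = quotient_map (p * r)"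
proof -
  have eq: "N +>\<^bsub>free_algebra X\<^esub> (x * y) = quotient_map (p * r)"
    if x: "x \<in> quotient_map p" and y: "y \<in> quotient_map r" for x y
  proof -
    from x y have xy: "x - supported p \<in> N" "y - supported r \<in> N" by (auto simp: quotient_map_altdef)
    from relations_carrier[OF xy(1)] relations_carrier[OF xy(2)]
    have sup: "supported x = x" "supported y = y" by (simp_all add: carrier_free_algebra)
    have "cg free_relations x p" "cg free_relations y r"
      using xy sup by (simp_all add: cg_def free_relations_def)
    then have "cg free_relations (x * y) (p * r)"
      by (rule cg_mult[OF ideal_free_relations])
    then show ?thesis using sup by (simp add: quotient_map_eq[symmetric]) (simp add: quotient_map_def)
  qed
  \<comment> \<open>The coset product is a union over pairs of representatives; these witnesses show
    that it is not empty.\<close>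
  have "supported p \<in> quotient_map p" "supported r \<in> quotient_map r"
    by (simp_all add: quotient_map_altdef algebra_ideal_generated.zero)
  then show ?thesis
    using eq by (auto simp: FactRing_def rcoset_mult_def free_algebra_def)
qed

end

end

section \<open>The Leavitt path algebra as an instance\<close>

definition mon :: "'g list \<Rightarrow> 'g word \<Rightarrow>\<^sub>0 'k::field" where
  "mon xs = Poly_Mapping.single (Word xs) 1"

lemma mon_Nil: "mon [] = 1"
  by (simp add: mon_def zero_word_def[symmetric])

lemma mon_append: "mon (xs @ ys) = mon xs * mon ys"
  by (simp add: mon_def mult_single Word_add)

lemma mon_Cons: "mon (x # xs) = gen x * mon xs"
  using mon_append[of "[x]" xs] by (simp add: mon_def gen_def)

lemma single_mon: "Poly_Mapping.single w c = Poly_Mapping.single 0 c * mon (letters w)"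
  by (simp add: mon_def mult_single)

fun gen_source :: "('v, 'e) pre_digraph \<Rightarrow> ('v, 'e) lpa_generator \<Rightarrow> 'v" where
  "gen_source E (Vertex v) = v"
| "gen_source E (Edge e) = tail E e"
| "gen_source E (Ghost e) = head E e"

fun gen_range :: "('v, 'e) pre_digraph \<Rightarrow> ('v, 'e) lpa_generator \<Rightarrow> 'v" where
  "gen_range E (Vertex v) = v"
| "gen_range E (Edge e) = head E e"
| "gen_range E (Ghost e) = tail E e"

context wf_digraph
begin

lemma lpa_generators_simps [simp]:
  "Vertex v \<in> lpa_generators G \<longleftrightarrow> v \<in> verts G"
  "Edge e \<in> lpa_generators G \<longleftrightarrow> e \<in> arcs G"
  "Ghost e \<in> lpa_generators G \<longleftrightarrow> e \<in> arcs G"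
  by (auto simp: lpa_generators_def)

lemma lpa_relators_intros:
  "v \<in> verts G \<Longrightarrow> w \<in> verts G \<Longrightarrow>
    gen (Vertex v) * gen (Vertex w) - (if v = w then gen (Vertex v) else 0) \<in> lpa_relators G"
  "e \<in> arcs G \<Longrightarrow> gen (Vertex (tail G e)) * gen (Edge e) - gen (Edge e) \<in> lpa_relators G"
  "e \<in> arcs G \<Longrightarrow> gen (Edge e) * gen (Vertex (head G e)) - gen (Edge e) \<in> lpa_relators G"
  "e \<in> arcs G \<Longrightarrow> gen (Vertex (head G e)) * gen (Ghost e) - gen (Ghost e) \<in> lpa_relators G"
  "e \<in> arcs G \<Longrightarrow> gen (Ghost e) * gen (Vertex (tail G e)) - gen (Ghost e) \<in> lpa_relators G"
  "e \<in> arcs G \<Longrightarrow> f \<in> arcs G \<Longrightarrow>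
    gen (Ghost e) * gen (Edge f) - (if e = f then gen (Vertex (head G f)) else 0) \<in> lpa_relators G"
  unfolding lpa_relators_def by blast+

lemma lpa_relators_carrier:
  "(lpa_relators G :: (_ \<Rightarrow>\<^sub>0 'k::field) set) \<subseteq> carrier (free_algebra (lpa_generators G))"
  unfolding lpa_relators_def
  by (auto simp: carrier_free_algebra lookup_mult_0 lookup_minus regular_vertex_def
      lookup_sum intro!: sum.cong sum.neutral)

abbreviation (input) "lpa_N \<equiv> free_relations (lpa_generators G) (lpa_relators G)"

lemma lpa_family:
  "leavitt_family G (lpa_N :: (('a, 'b) lpa_generator word \<Rightarrow>\<^sub>0 'k::field) set)
     (Poly_Mapping.single 0) (\<lambda>v. gen (Vertex v)) (\<lambda>e. gen (Edge e)) (\<lambda>e. gen (Ghost e))"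
proof -
  note rel = lpa_relators_carrier[where 'k = 'k]
  note N_def = free_relations_def[OF rel]
  have zero: "0 \<in> algebra_ideal_generated (lpa_generators G) (lpa_relators G :: (_ \<Rightarrow>\<^sub>0 'k) set)"
    by (rule algebra_ideal_generated.zero)
  have gen: "p \<in> lpa_N" if "p \<in> lpa_relators G" for p :: "_ \<Rightarrow>\<^sub>0 'k"
  proof -
    have "supported (lpa_generators G) p = p"
      using subsetD[OF rel that] by (simp add: carrier_free_algebra)
    with that show ?thesis by (simp add: N_def algebra_ideal_generated.generator)
  qed
  note relI = lpa_relators_intros
  show ?thesis
  proof
    show "ring_ideal (lpa_N :: (_ \<Rightarrow>\<^sub>0 'k) set)" by (rule ideal_free_relations[OF rel])
    show "Poly_Mapping.single 0 (c + d) = Poly_Mapping.single 0 c + Poly_Mapping.single 0 d" for c d :: 'k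
      by (rule single_add)
    show "Poly_Mapping.single 0 (c * d) = Poly_Mapping.single 0 c * Poly_Mapping.single 0 d" for c d :: 'k
      by (simp add: mult_single)
    show "Poly_Mapping.single 0 (1::'k) = 1" by (simp add: single_one)
    show "x * Poly_Mapping.single 0 c = Poly_Mapping.single 0 c * x"
      for c :: 'k and x :: "('a, 'b) lpa_generator word \<Rightarrow>\<^sub>0 'k"
      by (rule single_0_central)
    let ?A = "generated_algebra (range (Poly_Mapping.single 0) \<union> range (\<lambda>v. gen (Vertex v)) \<union>
      range (\<lambda>e. gen (Edge e)) \<union> range (\<lambda>e. gen (Ghost e))) :: (('a, 'b) lpa_generator word \<Rightarrow>\<^sub>0 'k) set"
    have scal: "Poly_Mapping.single 0 c \<in> ?A" for c by (auto intro: generated_algebra.base)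
    have "gen x \<in> ?A" for x by (cases x) (auto intro: generated_algebra.base)
    then have mon: "mon xs \<in> ?A" for xs
      using scal[of 1] by (induction xs) (auto simp: mon_Nil mon_Cons intro: generated_algebra.mult)
    have "p \<in> ?A" for p
    proof (induction p rule: poly_mapping_single_induct)
      case (single k v)
      show ?case unfolding single_mon[of k] by (intro generated_algebra.mult scal mon)
    qed (rule generated_algebra.add)
    then show "?A = UNIV" by blast
    fix v w :: 'a and e f :: 'b
    \<comment> \<open>From here on, symbols of the graph are handled by the relators, and symbols
      outside it are sent to 0 by \<open>supported\<close>.\<close>
    show "cg lpa_N (gen (Vertex v) * gen (Vertex v)) (gen (Vertex v) :: _ \<Rightarrow>\<^sub>0 'k)"
      unfolding cg_def using gen[OF relI(1), of v v] by (cases "v \<in> verts G") (simp_all add: N_def zero)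
    show "gen (Vertex v) * gen (Vertex w) \<in> (lpa_N :: (_ \<Rightarrow>\<^sub>0 'k) set)" if "v \<noteq> w"
      using that gen[OF relI(1), of v w]
      by (cases "v \<in> verts G \<and> w \<in> verts G") (auto simp: N_def zero)
    show "cg lpa_N (gen (Vertex (tail G e)) * gen (Edge e)) (gen (Edge e) :: _ \<Rightarrow>\<^sub>0 'k)"
      unfolding cg_def using gen[OF relI(2), of e] by (cases "e \<in> arcs G") (simp_all add: N_def zero)
    show "cg lpa_N (gen (Edge e) * gen (Vertex (head G e))) (gen (Edge e) :: _ \<Rightarrow>\<^sub>0 'k)"
      unfolding cg_def using gen[OF relI(3), of e] by (cases "e \<in> arcs G") (simp_all add: N_def zero)
    show "cg lpa_N (gen (Vertex (head G e)) * gen (Ghost e)) (gen (Ghost e) :: _ \<Rightarrow>\<^sub>0 'k)"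
      unfolding cg_def using gen[OF relI(4), of e] by (cases "e \<in> arcs G") (simp_all add: N_def zero)
    show "cg lpa_N (gen (Ghost e) * gen (Vertex (tail G e))) (gen (Ghost e) :: _ \<Rightarrow>\<^sub>0 'k)"
      unfolding cg_def using gen[OF relI(5), of e] by (cases "e \<in> arcs G") (simp_all add: N_def zero)
    show "cg lpa_N (gen (Ghost e) * gen (Edge e)) (gen (Vertex (head G e)) :: _ \<Rightarrow>\<^sub>0 'k)"
      if "e \<in> arcs G"
      using that gen[OF relI(6), of e e] unfolding cg_def by simp
    show "gen (Ghost e) * gen (Edge f) \<in> (lpa_N :: (_ \<Rightarrow>\<^sub>0 'k) set)" if "e \<noteq> f"
      using that gen[OF relI(6), of e f]
      by (cases "e \<in> arcs G \<and> f \<in> arcs G") (auto simp: N_def zero)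
    show "gen (Vertex v) \<in> (lpa_N :: (_ \<Rightarrow>\<^sub>0 'k) set)" if "v \<notin> verts G"
      using that by (simp add: N_def zero)
    show "gen (Edge e) \<in> (lpa_N :: (_ \<Rightarrow>\<^sub>0 'k) set)" if "e \<notin> arcs G"
      using that by (simp add: N_def zero)
    show "gen (Ghost e) \<in> (lpa_N :: (_ \<Rightarrow>\<^sub>0 'k) set)" if "e \<notin> arcs G"
      using that by (simp add: N_def zero)
  qed
qed

lemma lpa_quotient:
  "leavitt_quotient G (lpa_N :: (('a, 'b) lpa_generator word \<Rightarrow>\<^sub>0 'k::field) set)
     (Poly_Mapping.single 0) (\<lambda>v. gen (Vertex v)) (\<lambda>e. gen (Edge e)) (\<lambda>e. gen (Ghost e))
     {p. Poly_Mapping.lookup p 0 = 0} (leavitt_path_algebra G)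
     (quotient_map (lpa_generators G) (lpa_relators G))"
proof -
  note rel = lpa_relators_carrier[where 'k = 'k]
  interpret F: leavitt_family G "lpa_N :: (('a, 'b) lpa_generator word \<Rightarrow>\<^sub>0 'k) set"
    "Poly_Mapping.single 0" "\<lambda>v. gen (Vertex v)" "\<lambda>e. gen (Edge e)" "\<lambda>e. gen (Ghost e)"
    by (rule lpa_family)
  let ?V = "\<lambda>v. gen (Vertex v) :: ('a, 'b) lpa_generator word \<Rightarrow>\<^sub>0 'k"
  have source: "cg lpa_N (?V (gen_source G g) * gen g) (gen g)" for g
    using F.V_V F.V_Ed F.V_Gh by (cases g) auto
  have "range": "cg lpa_N (gen g * ?V (gen_range G g)) (gen g)" for g
    using F.V_V F.Ed_V F.Gh_V by (cases g) auto
  \<comment> \<open>Distinct vertices are orthogonal, so of the whole sum only u acts on x.\<close>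
  have unit_left: "cg lpa_N ((\<Sum>v\<in>S. ?V v) * x) x"
    if "finite S" "u \<in> S" "cg lpa_N (?V u * x) x" for S u and x :: "_ \<Rightarrow>\<^sub>0 'k"
  proof -
    have "cg lpa_N (?V v * x) (if v = u then x else 0)" for v
    proof (cases "v = u")
      case False
      have "cg lpa_N (?V v * x) (?V v * (?V u * x))" by (rule F.R_left[OF F.R_sym[OF that(3)]])
      moreover have "?V v * ?V u * x \<in> lpa_N" by (rule ideal_right[OF F.ideal_R F.V_W[OF False]])
      ultimately show ?thesis using F.R_mem_iff False by (auto simp: F.R_0_iff mult.assoc)
    qed (use that in simp)
    then have "cg lpa_N (\<Sum>v\<in>S. ?V v * x) (\<Sum>v\<in>S. if v = u then x else 0)" by (intro F.R_sum)
    then show ?thesis using that by (simp add: sum_distrib_right)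
  qed
  have unit_right: "cg lpa_N (x * (\<Sum>v\<in>S. ?V v)) x"
    if "finite S" "u \<in> S" "cg lpa_N (x * ?V u) x" for S u and x :: "_ \<Rightarrow>\<^sub>0 'k"
  proof -
    have "cg lpa_N (x * ?V v) (if v = u then x else 0)" for v
    proof (cases "v = u")
      case False
      have "cg lpa_N (x * ?V v) (x * ?V u * ?V v)" by (rule F.R_right[OF F.R_sym[OF that(3)]])
      moreover have "x * (?V u * ?V v) \<in> lpa_N"
        by (rule ideal_left[OF F.ideal_R F.V_W]) (use False in auto)
      ultimately show ?thesis using F.R_mem_iff False by (auto simp: F.R_0_iff mult.assoc)
    qed (use that in simp)
    then have "cg lpa_N (\<Sum>v\<in>S. x * ?V v) (\<Sum>v\<in>S. if v = u then x else 0)" by (intro F.R_sum)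
    then show ?thesis using that by (simp add: sum_distrib_left)
  qed
  \<comment> \<open>Local units exist only without constant term. Removing it gives an additive
    claim about every p, as the induction over monomials requires.\<close>
  define aug :: "(('a, 'b) lpa_generator word \<Rightarrow>\<^sub>0 'k) \<Rightarrow> _" where
    "aug p = p - Poly_Mapping.single 0 (Poly_Mapping.lookup p 0)" for p
  \<comment> \<open>Allowing all finite sets beyond a threshold lets two summands use the same
    set.\<close>
  have units: "\<exists>S\<^sub>0. finite S\<^sub>0 \<and> (\<forall>S. S\<^sub>0 \<subseteq> S \<longrightarrow> finite S \<longrightarrow>
      cg lpa_N (aug p) ((\<Sum>v\<in>S. ?V v) * aug p * (\<Sum>v\<in>S. ?V v)))" for p
  proof (induction p rule: poly_mapping_single_induct)
    case (single w c)
    show ?case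
    proof (cases "letters w = []")
      case True
      then have "aug (Poly_Mapping.single w c) = 0" by (simp add: aug_def word_eq_0_iff[symmetric])
      then show ?thesis by (auto intro: F.R_refl)
    next
      case False
      then have "aug (Poly_Mapping.single w c) = Poly_Mapping.single w c"
        by (simp add: aug_def lookup_single when_def word_eq_0_iff)
      then have aug: "aug (Poly_Mapping.single w c) = Poly_Mapping.single 0 c * mon (letters w)"
        using single_mon[of w c] by simp
      \<comment> \<open>The source of the first letter and the range of the last one serve as
        threshold for a monomial.\<close>
      from False obtain g xs where g: "letters w = g # xs" by (cases "letters w") auto
      from False obtain h ys where h: "letters w = ys @ [h]" by (cases "letters w" rule: rev_cases) auto
      let ?m = "mon (letters w) :: _ \<Rightarrow>\<^sub>0 'k"
      have "cg lpa_N (?V (gen_source G g) * gen g * mon xs) (gen g * mon xs)"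
        by (rule F.R_right[OF source])
      then have l: "cg lpa_N (?V (gen_source G g) * ?m) ?m" by (simp add: g mon_Cons mult.assoc)
      have "cg lpa_N (mon ys * (gen h * ?V (gen_range G h))) (mon ys * gen h)"
        by (rule F.R_left[OF "range"])
      then have r: "cg lpa_N (?m * ?V (gen_range G h)) ?m"
        by (simp add: h mon_append mon_Cons mon_Nil mult.assoc)
      have "cg lpa_N (Poly_Mapping.single 0 c * ?m)
          ((\<Sum>v\<in>S. ?V v) * (Poly_Mapping.single 0 c * ?m) * (\<Sum>v\<in>S. ?V v))"
        if "{gen_source G g, gen_range G h} \<subseteq> S" "finite S" for S
      proof -
        have "cg lpa_N ((\<Sum>v\<in>S. ?V v) * ?m * (\<Sum>v\<in>S. ?V v)) (?m * (\<Sum>v\<in>S. ?V v))"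
          using that l by (intro F.R_right unit_left) auto
        also have "cg lpa_N \<dots> ?m" using that r by (intro unit_right) auto
        finally have "cg lpa_N (Poly_Mapping.single 0 c * ((\<Sum>v\<in>S. ?V v) * ?m * (\<Sum>v\<in>S. ?V v)))
            (Poly_Mapping.single 0 c * ?m)" by (rule F.R_left)
        then show ?thesis using F.R_sym by (simp add: mult.assoc F.scal_central2)
      qed
      then show ?thesis unfolding aug
        by (intro exI[of _ "{gen_source G g, gen_range G h}"]) auto
    qed
  next
    case (add a b)
    then obtain S T where S: "finite S" "finite T"
      "\<And>U. S \<subseteq> U \<Longrightarrow> finite U \<Longrightarrow> cg lpa_N (aug a) ((\<Sum>v\<in>U. ?V v) * aug a * (\<Sum>v\<in>U. ?V v))"
      "\<And>U. T \<subseteq> U \<Longrightarrow> finite U \<Longrightarrow> cg lpa_N (aug b) ((\<Sum>v\<in>U. ?V v) * aug b * (\<Sum>v\<in>U. ?V v))"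
      by blast
    have "aug (a + b) = aug a + aug b" by (simp add: aug_def lookup_add single_add)
    with S show ?case
      by (intro exI[of _ "S \<union> T"]) (auto simp: distrib_left distrib_right intro: F.R_add)
  qed
  show ?thesis
    unfolding leavitt_path_algebra_def
  proof (intro leavitt_quotient.intro leavitt_quotient_axioms.intro lpa_family)
    show "ring_ideal {p :: ('a, 'b) lpa_generator word \<Rightarrow>\<^sub>0 'k. Poly_Mapping.lookup p 0 = 0}"
      by (rule ring_idealI) (auto simp: lookup_add lookup_mult_0)
    show "?V v \<in> {p. Poly_Mapping.lookup p 0 = 0}" for v by simp
    show "lpa_N \<subseteq> {p :: ('a, 'b) lpa_generator word \<Rightarrow>\<^sub>0 'k. Poly_Mapping.lookup p 0 = 0}"
    proof
      fix p :: "('a, 'b) lpa_generator word \<Rightarrow>\<^sub>0 'k" assume "p \<in> lpa_N"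
      then have "supported (lpa_generators G) p \<in> carrier (free_algebra (lpa_generators G))"
        unfolding free_relations_def[OF rel] by (intro relations_carrier[OF rel]) simp
      then show "p \<in> {p. Poly_Mapping.lookup p 0 = 0}" by (simp add: carrier_free_algebra)
    qed
    show "F.local_units {p. Poly_Mapping.lookup p 0 = 0}"
      unfolding F.local_units_def
    proof
      fix p :: "('a, 'b) lpa_generator word \<Rightarrow>\<^sub>0 'k" assume "p \<in> {p. Poly_Mapping.lookup p 0 = 0}"
      then have "aug p = p" by (simp add: aug_def)
      with units[of p] show "\<exists>S. finite S \<and> cg lpa_N p ((\<Sum>v\<in>S. ?V v) * p * (\<Sum>v\<in>S. ?V v))"
        by auto
    qed
  qed (use quotient_map_eq[OF rel] carrier_quotient[OF rel] quotient_map_add[OF rel]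
      quotient_map_mult[OF rel] quotient_map_zero[OF rel] in auto)
qed

end

theorem theorem8:
  fixes E :: "('v, 'e) pre_digraph"
    and L :: "(('v, 'e) lpa_generator word \<Rightarrow>\<^sub>0 'k::field) set ring"
    and I P :: "(('v, 'e) lpa_generator word \<Rightarrow>\<^sub>0 'k) set set"
  defines "L \<equiv> leavitt_path_algebra E"
  assumes "wf_digraph E" and "countable (verts E)" and "countable (arcs E)"
    and "two_sided_ideal I L" and "I \<noteq> {\<zero>\<^bsub>L\<^esub>}"
    and "ideal_radical L I = P" and "prime_two_sided_ideal P L"
  shows "\<exists>n\<ge>1. I = ideal_power L P n"
  using leavitt_quotient.radical_prime_power[OF wf_digraph.lpa_quotient[OF assms(2)]] assms(5-8)
  unfolding L_def by blast

end
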